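(* Let $N=N_R+iN_I$ be a normal operator in a complex Hilbert space $\mathcal{H}$ such that $\{z\in\mathbb{C}:\operatorname{Re}z>0\}\subset\varrho(N)$. Then: (i) All orbits of $(e^{tN})_{t\ge0}$ converge to zero with exponential rate if, and only if, $0\notin\sigma(N_R)$. (ii) The set \[\mathcal{G}_N(\alpha,\beta):=\{x\in\mathcal{H}:\limsup_{t\to\infty}\alpha(t)\|e^{tN}x\|_{\mathcal{H}}=\infty\ \text{ and }\ \liminf_{t\to\infty}\beta(t)\|e^{tN}x\|_{\mathcal{H}}=0\}\] is a dense $G_\delta$ set in $\mathcal{H}$ for every pair of functions $\alpha,\beta:\mathbb{R}_+\to(0,\infty)$ satisfying $\lim_{t\to\infty}\alpha(t)=\infty$ and $\lim_{t\to\infty}\beta(t)e^{-t\epsilon}=0$ for all $\epsilon>0$ if, and only if, $0\in\sigma(N_R)$ and $0$ is not an eigenvalue of $N_R$. (iii) The set $\mathcal{F}_N$ of $x\in\mathcal{H}$ such that $e^{tN}x$ does not converge to zero as $t\to\infty$ is a dense open set in $\mathcal{H}$ if, and only if, $0$ is an eigenvalue of $N_R$.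
   Context: $\mathbb{R}_+=[0,\infty)$; $\sigma(\cdot)$ and $\varrho(\cdot)$ denote spectrum and resolvent set. $N$ may be unbounded, with resolution of the identity $E^N$, and $e^{tN}=\int_{\sigma(N)}e^{t\lambda}\,dE^N(\lambda)$, which is a $C_0$-semigroup of normal contractions generated by $N$. Every normal operator $N$ is written $N=N_R+iN_I$ with commuting self-adjoint operators $N_R=\frac{N+N^*}{2}$ and $N_I=-i\frac{N-N^*}{2}$; that is, $N_R$ is the self-adjoint operator $\int\operatorname{Re}(\lambda)\,dE^N(\lambda)$ and $N_I$ is the self-adjoint operator $\int\operatorname{Im}(\lambda)\,dE^N(\lambda)$. "All orbits converge to zero with exponential rate" means that for every $x\in\mathcal{H}$ there exist $C,\epsilon>0$ such that $\|e^{tN}x\|_{\mathcal{H}}\le Ce^{-\epsilon t}$ for all $t\ge0$. *)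

theory Defs
  imports "HOL-Analysis.Analysis"
begin

section \<open>Complex Hilbert spaces\<close>

text \<open>
  The norm, metric and topology are those of the underlying real Hilbert space, whose inner
  product is the real part of the complex one. The complex inner product is linear in its first
  argument.
\<close>

class complex_hilbert_space = real_inner + banach +
  fixes scaleC :: "complex \<Rightarrow> 'a \<Rightarrow> 'a"  (infixr \<open>*\<^sub>C\<close> 75)
    and cinner :: "'a \<Rightarrow> 'a \<Rightarrow> complex"
  assumes scaleC_add_right: "a *\<^sub>C (x + y) = a *\<^sub>C x + a *\<^sub>C y"
    and scaleC_add_left: "(a + b) *\<^sub>C x = a *\<^sub>C x + b *\<^sub>C x"
    and scaleC_scaleC: "a *\<^sub>C b *\<^sub>C x = (a * b) *\<^sub>C x"
    and scaleC_of_real: "complex_of_real r *\<^sub>C x = r *\<^sub>R x"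
    and cinner_commute: "cinner x y = cnj (cinner y x)"
    and cinner_add_left: "cinner (x + y) z = cinner x z + cinner y z"
    and cinner_scaleC_left: "cinner (a *\<^sub>C x) y = a * cinner x y"
    and Re_cinner: "Re (cinner x y) = inner x y"

instantiation complex :: complex_hilbert_space
begin

definition scaleC_complex :: "complex \<Rightarrow> complex \<Rightarrow> complex"
  where "scaleC_complex a x = a * x"

definition cinner_complex :: "complex \<Rightarrow> complex \<Rightarrow> complex"
  where "cinner_complex x y = x * cnj y"

instance
  by standard
    (simp_all add: scaleC_complex_def cinner_complex_def algebra_simps scaleR_conv_of_real
      inner_complex_def)

end

definition bounded_clinear :: "('a::complex_hilbert_space \<Rightarrow> 'a) \<Rightarrow> bool"
  where "bounded_clinear T \<longleftrightarrow> bounded_linear T \<and> (\<forall>c x. T (c *\<^sub>C x) = c *\<^sub>C T x)"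


section \<open>Unbounded operators\<close>

text \<open>
  A possibly unbounded operator is represented by its graph. Its domain is the \<^const>\<open>Domain\<close> of
  the graph, composition of operators (with the natural domain) is relational composition
  \<^term>\<open>(O)\<close>, read from left to right, and equality of operators includes equality of domains.
\<close>

type_synonym 'a operator = "('a \<times> 'a) set"

definition linear_operator :: "'a::complex_hilbert_space operator \<Rightarrow> bool"
  where "linear_operator A \<longleftrightarrow> single_valued A \<and> (0, 0) \<in> A \<and>
    (\<forall>x y x' y'. (x, y) \<in> A \<longrightarrow> (x', y') \<in> A \<longrightarrow> (x + x', y + y') \<in> A) \<and>
    (\<forall>c x y. (x, y) \<in> A \<longrightarrow> (c *\<^sub>C x, c *\<^sub>C y) \<in> A)"

definition op_apply :: "'a operator \<Rightarrow> 'a \<Rightarrow> 'a"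
  where "op_apply A x = (THE y. (x, y) \<in> A)"

definition adjoint_op :: "'a::complex_hilbert_space operator \<Rightarrow> 'a operator"
  where "adjoint_op A = {(y, z). \<forall>(x, w) \<in> A. cinner w y = cinner x z}"

definition normal_operator :: "'a::complex_hilbert_space operator \<Rightarrow> bool"
  where "normal_operator N \<longleftrightarrow> linear_operator N \<and> closure (Domain N) = UNIV \<and> closed N \<and>
    N O adjoint_op N = adjoint_op N O N"

text \<open>
  The point \<open>z\<close> is in the resolvent set of \<open>A\<close> iff the inverse of \<open>z - A\<close>, defined on the range
  of \<open>z - A\<close>, is an everywhere defined bounded operator.
\<close>

definition resolvent_set :: "'a::complex_hilbert_space operator \<Rightarrow> complex set"
  where "resolvent_set A =
    {z. \<exists>R. bounded_clinear R \<and> {(x, z *\<^sub>C x - y) |x y. (x, y) \<in> A}\<inverse> = {(w, R w) |w. True}}"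

definition spectrum :: "'a::complex_hilbert_space operator \<Rightarrow> complex set"
  where "spectrum A = - resolvent_set A"

definition eigenvalue :: "'a::complex_hilbert_space operator \<Rightarrow> complex \<Rightarrow> bool"
  where "eigenvalue A z \<longleftrightarrow> (\<exists>x. x \<noteq> 0 \<and> (x, z *\<^sub>C x) \<in> A)"


section \<open>Resolutions of the identity and spectral integrals\<close>

definition orthogonal_projection :: "('a::complex_hilbert_space \<Rightarrow> 'a) \<Rightarrow> bool"
  where "orthogonal_projection P \<longleftrightarrow> bounded_clinear P \<and> (\<forall>x. P (P x) = P x) \<and>
    (\<forall>x y. cinner (P x) y = cinner x (P y))"

text \<open>
  Projection-valued measures on the Borel sets of the complex plane; the values of \<open>E\<close> on other
  sets are irrelevant. Countable additivity is in the strong operator topology.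
\<close>

definition spectral_measure :: "(complex set \<Rightarrow> 'a::complex_hilbert_space \<Rightarrow> 'a) \<Rightarrow> bool"
  where "spectral_measure E \<longleftrightarrow>
    (\<forall>B\<in>sets borel. orthogonal_projection (E B)) \<and>
    (\<forall>x. E {} x = 0) \<and> (\<forall>x. E UNIV x = x) \<and>
    (\<forall>B\<in>sets borel. \<forall>B'\<in>sets borel. \<forall>x. E (B \<inter> B') x = E B (E B' x)) \<and>
    (\<forall>B::nat \<Rightarrow> complex set. range B \<subseteq> sets borel \<longrightarrow> disjoint_family B \<longrightarrow>
      (\<forall>x. (\<lambda>n. E (B n) x) sums E (\<Union>n. B n) x))"

definition scalar_spectral_measure ::
    "(complex set \<Rightarrow> 'a::complex_hilbert_space \<Rightarrow> 'a) \<Rightarrow> 'a \<Rightarrow> complex measure"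
  where "scalar_spectral_measure E x =
    measure_of UNIV (sets borel) (\<lambda>B. ennreal (Re (cinner (E B x) x)))"

definition simple_spectral_integral ::
    "(complex set \<Rightarrow> 'a::complex_hilbert_space \<Rightarrow> 'a) \<Rightarrow> (complex \<Rightarrow> complex) \<Rightarrow> 'a \<Rightarrow> 'a"
  where "simple_spectral_integral E s x = (\<Sum>c\<in>range s. c *\<^sub>C E (s -` {c}) x)"

text \<open>
  The operator \<open>\<integral> f dE\<close> for a Borel function \<open>f\<close>: since \<open>\<parallel>\<integral> s dE x\<parallel>\<^sup>2 = \<integral> \<bar>s\<bar>\<^sup>2 dE\<^sub>x\<^sub>,\<^sub>x\<close> for simple
  \<open>s\<close>, the value at \<open>x\<close> is the limit of \<open>\<integral> s dE x\<close> as \<open>s\<close> tends to \<open>f\<close> in \<open>L\<^sup>2(E\<^sub>x\<^sub>,\<^sub>x)\<close>. As simple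
  functions are dense in \<open>L\<^sup>2(E\<^sub>x\<^sub>,\<^sub>x)\<close>, the domain consists of the \<open>x\<close> with
  \<open>\<integral> \<bar>f\<bar>\<^sup>2 dE\<^sub>x\<^sub>,\<^sub>x < \<infinity>\<close>.
\<close>

definition spectral_integral ::
    "(complex set \<Rightarrow> 'a::complex_hilbert_space \<Rightarrow> 'a) \<Rightarrow> (complex \<Rightarrow> complex) \<Rightarrow> 'a operator"
  where "spectral_integral E f =
    {(x, y). \<exists>s::nat \<Rightarrow> complex \<Rightarrow> complex. (\<forall>n. simple_function borel (s n)) \<and>
      (\<lambda>n. \<integral>\<^sup>+z. ennreal ((cmod (f z - s n z))\<^sup>2) \<partial>scalar_spectral_measure E x) \<longlonglongrightarrow> 0 \<and>
      (\<lambda>n. simple_spectral_integral E (s n) x) \<longlonglongrightarrow> y}"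

definition resolution_of_identity ::
    "'a::complex_hilbert_space operator \<Rightarrow> (complex set \<Rightarrow> 'a \<Rightarrow> 'a) \<Rightarrow> bool"
  where "resolution_of_identity N E \<longleftrightarrow> spectral_measure E \<and> N = spectral_integral E (\<lambda>z. z)"


section \<open>The real part and the semigroup of a normal operator\<close>

text \<open>In the following, \<open>E\<close> is the resolution of the identity of the normal operator \<open>N\<close>. The
  self-adjoint operator \<open>N\<^sub>R\<close> is \<open>\<integral> Re dE\<close>, on its maximal domain.\<close>

definition real_part_op :: "(complex set \<Rightarrow> 'a::complex_hilbert_space \<Rightarrow> 'a) \<Rightarrow> 'a operator"
  where "real_part_op E = spectral_integral E (\<lambda>z. complex_of_real (Re z))"

definition exp_op ::
    "'a::complex_hilbert_space operator \<Rightarrow> (complex set \<Rightarrow> 'a \<Rightarrow> 'a) \<Rightarrow> real \<Rightarrow> 'a \<Rightarrow> 'a"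
  where "exp_op N E t = op_apply (spectral_integral E
    (\<lambda>z. indicator (spectrum N) z * exp (complex_of_real t * z)))"

definition exponentially_decaying_orbits ::
    "'a::complex_hilbert_space operator \<Rightarrow> (complex set \<Rightarrow> 'a \<Rightarrow> 'a) \<Rightarrow> bool"
  where "exponentially_decaying_orbits N E \<longleftrightarrow>
    (\<forall>x. \<exists>C>0. \<exists>\<epsilon>>0. \<forall>t\<ge>0. norm (exp_op N E t x) \<le> C * exp (- \<epsilon> * t))"

text \<open>
  The functions \<open>\<alpha>\<close> and \<open>\<beta>\<close> are only relevant on \<open>[0, \<infinity>)\<close>; upper and lower limits are taken in
  the extended reals.
\<close>

definition G_set :: "'a::complex_hilbert_space operator \<Rightarrow> (complex set \<Rightarrow> 'a \<Rightarrow> 'a) \<Rightarrow>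
    (real \<Rightarrow> real) \<Rightarrow> (real \<Rightarrow> real) \<Rightarrow> 'a set"
  where "G_set N E \<alpha> \<beta> =
    {x. Limsup at_top (\<lambda>t. ereal (\<alpha> t * norm (exp_op N E t x))) = \<infinity> \<and>
        Liminf at_top (\<lambda>t. ereal (\<beta> t * norm (exp_op N E t x))) = 0}"

definition F_set :: "'a::complex_hilbert_space operator \<Rightarrow> (complex set \<Rightarrow> 'a \<Rightarrow> 'a) \<Rightarrow> 'a set"
  where "F_set N E = {x. \<not> ((\<lambda>t. exp_op N E t x) \<longlongrightarrow> 0) at_top}"

definition admissible_pair :: "(real \<Rightarrow> real) \<Rightarrow> (real \<Rightarrow> real) \<Rightarrow> bool"
  where "admissible_pair \<alpha> \<beta> \<longleftrightarrow> (\<forall>t\<ge>0. \<alpha> t > 0 \<and> \<beta> t > 0) \<and>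
    filterlim \<alpha> at_top at_top \<and> (\<forall>\<epsilon>>0. ((\<lambda>t. \<beta> t * exp (- t * \<epsilon>)) \<longlongrightarrow> 0) at_top)"

end

theory Submission
  imports Defs "HOL-Real_Asymp.Real_Asymp"
begin

text \<open>
  Since \<open>\<parallel>exp(tN) x\<parallel>\<^sup>2 = \<integral> exp(2t Re z) dE\<^sub>x\<^sub>,\<^sub>x\<close>, everything depends on how \<open>E\<close> charges the strips \<open>-r < Re z \<le> 0\<close>:
  \<open>0 \<notin> \<sigma>(N\<^sub>R)\<close> means that one of them is null, and \<open>0\<close> is an eigenvalue of \<open>N\<^sub>R\<close> iff the imaginary axis
  is not null. A null strip gives a uniform exponential rate. If the axis is charged, orbits
  starting in the range of its projection have constant norm, so the vectors with decaying orbits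
  form a proper closed subspace. In the remaining case the vectors supported in \<open>Re z \<le> -r\<close> for some
  \<open>r > 0\<close> are dense and decay exponentially, while every \<open>exp(tN)\<close> has norm \<open>1\<close>, so that uniform boundedness and
  Baire's theorem make the set in (ii) residual. The three cases are exhaustive and their conclusions
  mutually exclusive, which yields all the equivalences.
\<close>

text \<open>The obstacle is that \<open>spectral_integral\<close> is a bare graph: a value is the
  limit along some sequence of simple functions, which may depend on the vector. Existence,
  uniqueness, linearity and products all have to come from the isometry between
  \<open>norm (S s x)\<close> and the square integral \<open>sq x s\<close>; two values at one
  vector are then compared through the \<open>sq\<close>-distance of their integrands. The link
  between resolvent sets and null sets is proved for an arbitrary Borel \<open>f\<close>, because it
  is used twice: with the identity, to see that \<open>E\<close> lives on the spectrum of
  \<open>N\<close>, and with the real part, to translate the condition on the real part operator.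
  Since \<alpha> and \<beta> carry no regularity, the sets whose intersection is
  \<open>G_set\<close> are written as unions over real times of sets that are open by continuity in
  \<open>x\<close> alone. Orbit norms decrease in time because the integrand does, so an orbit tends
  to zero as soon as it takes arbitrarily small values. The three conclusions are separated with the
  single pair \<alpha>(t) = t + 1, \<beta>(t) = 1.\<close>

lemma scaleC_zero_left [simp]: "0 *\<^sub>C x = (0::'a::complex_hilbert_space)"
  using scaleC_of_real[of 0 x] by simp

lemma scaleC_one [simp]: "1 *\<^sub>C x = (x::'a::complex_hilbert_space)"
  using scaleC_of_real[of 1 x] by simp

lemma scaleC_zero_right [simp]: "c *\<^sub>C 0 = (0::'a::complex_hilbert_space)"
  using scaleC_add_right[of c 0 "0::'a"] by simp

lemma scaleC_minus_left: "(- c) *\<^sub>C x = - (c *\<^sub>C (x::'a::complex_hilbert_space))"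
  using scaleC_add_left[of c "- c" x] by (simp add: eq_neg_iff_add_eq_0 add.commute)

lemma scaleC_minus_right: "c *\<^sub>C (- x) = - (c *\<^sub>C (x::'a::complex_hilbert_space))"
  using scaleC_add_right[of c x "- x"] by (simp add: eq_neg_iff_add_eq_0 add.commute)

lemma scaleC_diff_left: "(c - d) *\<^sub>C x = c *\<^sub>C x - d *\<^sub>C (x::'a::complex_hilbert_space)"
  using scaleC_add_left[of c "- d" x] by (simp add: scaleC_minus_left)

lemma scaleC_diff_right: "c *\<^sub>C (x - y) = c *\<^sub>C x - c *\<^sub>C (y::'a::complex_hilbert_space)"
  using scaleC_add_right[of c x "- y"] by (simp add: scaleC_minus_right)

lemma scaleC_sum_right:
  "c *\<^sub>C (\<Sum>i\<in>I. f i) = (\<Sum>i\<in>I. c *\<^sub>C (f i::'a::complex_hilbert_space))"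
  by (induction I rule: infinite_finite_induct) (auto simp: scaleC_add_right)

text \<open>The class ties the norm only to the real part of \<open>cinner\<close>. Conjugate
  symmetry makes \<open>cinner x x\<close> real, hence equal to the squared norm, and
  sesquilinearity then extracts \<open>c * cnj c\<close>.\<close>

lemma norm_scaleC: "norm (c *\<^sub>C x) = cmod c * norm (x::'a::complex_hilbert_space)"
proof -
  have "cinner x x = complex_of_real ((norm x)\<^sup>2)"
  proof (rule complex_eqI)
    show "Im (cinner x x) = Im (complex_of_real ((norm x)\<^sup>2))"
      using arg_cong[OF cinner_commute[of x x], of Im] by simp
  qed (simp add: Re_cinner power2_norm_eq_inner)
  moreover have "cinner (c *\<^sub>C x) (c *\<^sub>C x) = c * cnj (c * cinner x x)"
    by (metis cinner_scaleC_left cinner_commute)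
  ultimately have "cinner (c *\<^sub>C x) (c *\<^sub>C x) = complex_of_real ((cmod c * norm x)\<^sup>2)"
    by (simp add: complex_norm_square[symmetric] power_mult_distrib mult.assoc[symmetric] del: of_real_power)
  then have "(norm (c *\<^sub>C x))\<^sup>2 = (cmod c * norm x)\<^sup>2"
    by (metis Re_cinner Re_complex_of_real power2_norm_eq_inner)
  then show ?thesis
    by (simp add: power2_eq_iff_nonneg)
qed

text \<open>Prepares the Pythagorean theorem, which concerns the real inner product: complex
  multiples stay orthogonal in the real sense only because the whole complex product vanishes, not
  just its real part.\<close>

lemma inner_scaleC_scaleC_eq_0:
  assumes "cinner x y = (0::complex)"
  shows "inner (c *\<^sub>C x) (d *\<^sub>C (y::'a::complex_hilbert_space)) = 0"
proof -
  have "cinner (c *\<^sub>C x) (d *\<^sub>C y) = c * cnj (d * cnj (cinner x y))"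
    by (metis cinner_scaleC_left cinner_commute)
  then show ?thesis
    using assms by (metis Re_cinner complex_cnj_zero mult_zero_right zero_complex.simps(1))
qed

lemma bounded_linear_scaleC: "bounded_linear (\<lambda>x::'a::complex_hilbert_space. c *\<^sub>C x)"
  by (rule bounded_linear_intro[where K = "cmod c"])
    (auto simp: scaleC_add_right norm_scaleC scaleC_scaleC mult.commute simp flip: scaleC_of_real)

lemma tendsto_scaleC:
  "(f \<longlongrightarrow> (l::'a::complex_hilbert_space)) F \<Longrightarrow> ((\<lambda>x. c *\<^sub>C f x) \<longlongrightarrow> c *\<^sub>C l) F"
  by (rule bounded_linear.tendsto[OF bounded_linear_scaleC])

section \<open>Scalar spectral measures and integrals of simple functions\<close>

locale spectral_resolution =
  fixes E :: "complex set \<Rightarrow> 'a::complex_hilbert_space \<Rightarrow> 'a"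
  assumes spectral_measure: "spectral_measure E"
begin

abbreviation \<mu> :: "'a \<Rightarrow> complex measure"
  where "\<mu> \<equiv> scalar_spectral_measure E"

abbreviation S :: "(complex \<Rightarrow> complex) \<Rightarrow> 'a \<Rightarrow> 'a"
  where "S \<equiv> simple_spectral_integral E"

abbreviation A :: "(complex \<Rightarrow> complex) \<Rightarrow> 'a operator"
  where "A \<equiv> spectral_integral E"

abbreviation sq :: "'a \<Rightarrow> (complex \<Rightarrow> complex) \<Rightarrow> ennreal"
  where "sq x f \<equiv> \<integral>\<^sup>+z. ennreal ((cmod (f z))\<^sup>2) \<partial>\<mu> x"

lemma orthogonal_projection_E: "B \<in> sets borel \<Longrightarrow> orthogonal_projection (E B)"
  using spectral_measure unfolding spectral_measure_def by (elim conjE) (erule (1) bspec)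

lemma bounded_linear_E: "B \<in> sets borel \<Longrightarrow> bounded_linear (E B)"
  and E_scaleC: "B \<in> sets borel \<Longrightarrow> E B (c *\<^sub>C x) = c *\<^sub>C E B x"
  and cinner_E: "B \<in> sets borel \<Longrightarrow> cinner (E B x) y = cinner x (E B y)"
  and E_idem: "B \<in> sets borel \<Longrightarrow> E B (E B x) = E B x"
  by (drule orthogonal_projection_E, simp only: orthogonal_projection_def bounded_clinear_def)+

lemma E_empty: "E {} x = 0"
  and E_UNIV: "E UNIV x = x"
  using spectral_measure unfolding spectral_measure_def by (simp_all only: simp_thms)

lemma E_Int: "B \<in> sets borel \<Longrightarrow> C \<in> sets borel \<Longrightarrow> E (B \<inter> C) x = E B (E C x)"
  using spectral_measure unfolding spectral_measure_def by (elim conjE) simp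

lemma E_sums:
  fixes B :: "nat \<Rightarrow> complex set"
  assumes "range B \<subseteq> sets borel" "disjoint_family B"
  shows "(\<lambda>n. E (B n) x) sums E (\<Union>n. B n) x"
  using spectral_measure assms unfolding spectral_measure_def by (elim conjE) simp

lemma E_Un:
  assumes "B \<in> sets borel" "C \<in> sets borel" "B \<inter> C = {}"
  shows "E (B \<union> C) x = E B x + E C x"
proof -
  have "(\<lambda>n. E (binaryset B C n) x) sums E (\<Union>n. binaryset B C n) x"
    using assms by (intro E_sums) (auto simp: binaryset_def disjoint_family_on_def)
  moreover have "(\<lambda>n. E (binaryset B C n) x) sums (E B x + E C x)"
    using binaryset_sums[of "\<lambda>B. E B x" B C] by (simp add: E_empty)
  ultimately show ?thesis
    unfolding UN_binaryset_eq by (rule sums_unique2)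
qed

lemma E_finite_UN:
  assumes "finite I" "\<And>i. i \<in> I \<Longrightarrow> B i \<in> sets borel" "disjoint_family_on B I"
  shows "E (\<Union>i\<in>I. B i) x = (\<Sum>i\<in>I. E (B i) x)"
  using assms
proof (induction I rule: finite_induct)
  case empty
  then show ?case by (simp add: E_empty)
next
  case (insert i I)
  have "B i \<inter> (\<Union>j\<in>I. B j) = {}"
    using insert.prems(2) insert.hyps by (fastforce simp: disjoint_family_on_def)
  moreover have "disjoint_family_on B I"
    using insert.prems(2) by (auto simp: disjoint_family_on_def)
  moreover have "(\<Union>j\<in>I. B j) \<in> sets borel"
    using insert.prems(1) insert.hyps by (intro sets.finite_UN) auto
  moreover have "E (\<Union>j\<in>I. B j) x = (\<Sum>j\<in>I. E (B j) x)"
    using insert.IH insert.prems(1) calculation(2) by blast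
  ultimately show ?case
    using insert.hyps insert.prems(1) E_Un[of "B i" "\<Union>j\<in>I. B j" x]
    by (simp add: insertI1)
qed

lemma cinner_E_disjoint:
  assumes "B \<in> sets borel" "C \<in> sets borel" "B \<inter> C = {}"
  shows "cinner (E B x) (E C y) = 0"
proof -
  have "cinner (E B x) (E C y) = cinner (E C (E B x)) y"
    using assms by (simp add: cinner_E)
  also have "E C (E B x) = 0 *\<^sub>C x"
    using assms by (simp add: E_Int[symmetric] Int_commute E_empty)
  finally show ?thesis by (simp only: cinner_scaleC_left mult_zero_left)
qed

lemma inner_E: "B \<in> sets borel \<Longrightarrow> inner (E B x) x = (norm (E B x))\<^sup>2"
  using cinner_E[of B "E B x" x] by (metis E_idem Re_cinner power2_norm_eq_inner)

lemma sets_scalar_spectral_measure [simp, measurable_cong]: "sets (\<mu> x) = sets borel"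
  unfolding scalar_spectral_measure_def
  using sets.sets_measure_of_eq[of "borel::complex measure"] by (simp only: space_borel)

lemma space_scalar_spectral_measure [simp]: "space (\<mu> x) = UNIV"
  using sets_eq_imp_space_eq[OF sets_scalar_spectral_measure] by simp

text \<open>\<open>measure_of\<close> has the prescribed values only once these are known to be
  countably additive. That is strong additivity of \<open>E\<close> tested against \<open>x\<close>;
  the squared norm appears because \<open>E B\<close> is a self-adjoint idempotent.\<close>

lemma emeasure_scalar_spectral_measure:
  assumes "B \<in> sets borel"
  shows "emeasure (\<mu> x) B = ennreal ((norm (E B x))\<^sup>2)"
proof -
  have "countably_additive (sets borel) (\<lambda>B. ennreal (Re (cinner (E B x) x)))"
    unfolding countably_additive_def
  proof (intro allI impI)
    fix C :: "nat \<Rightarrow> complex set"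
    assume C: "range C \<subseteq> sets borel" "disjoint_family C"
    have "(\<lambda>n. inner (E (C n) x) x) sums inner (E (\<Union>n. C n) x) x"
      using E_sums[OF C] by (rule bounded_linear.sums[OF bounded_linear_inner_left])
    then show "(\<Sum>n. ennreal (Re (cinner (E (C n) x) x)))
        = ennreal (Re (cinner (E (\<Union>n. C n) x) x))"
      using C by (intro suminf_ennreal_eq) (auto simp: Re_cinner inner_E image_subset_iff)
  qed
  moreover have "positive (sets borel) (\<lambda>B. ennreal (Re (cinner (E B x) x)))"
    by (simp add: positive_def E_empty Re_cinner)
  ultimately show ?thesis
    using assms sets.sigma_algebra_axioms[of "borel::complex measure"]
    unfolding scalar_spectral_measure_def
    by (subst emeasure_measure_of_sigma) (auto simp: Re_cinner inner_E)
qed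

section \<open>Algebra and isometry of integrals of simple functions\<close>

lemma simple_function_borel_iff:
  "simple_function borel s \<longleftrightarrow> finite (range s) \<and> (\<forall>c. s -` {c} \<in> sets (borel::complex measure))"
proof -
  have "s -` {c} \<in> sets (borel::complex measure)"
    if "\<forall>c\<in>range s. s -` {c} \<in> sets (borel::complex measure)" for c
  proof (cases "c \<in> range s")
    case False
    then have "s -` {c} = {}" by auto
    then show ?thesis by simp
  qed (use that in auto)
  then show ?thesis
    unfolding simple_function_def space_borel Int_UNIV_right by blast
qed

text \<open>\<open>h\<close> may identify several values of \<open>p\<close>, so each level set of
  the composition is a finite disjoint union of level sets of \<open>p\<close>, and finite
  additivity of \<open>E\<close> regroups the sum.\<close>

lemma simple_spectral_integral_comp:
  assumes "simple_function borel p"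
  shows "S (\<lambda>z. h (p z)) x = (\<Sum>b\<in>range p. h b *\<^sub>C E (p -` {b}) x)"
proof -
  have p: "finite (range p)" "\<And>b. p -` {b} \<in> sets borel"
    using assms unfolding simple_function_borel_iff by blast+
  have "E ((\<lambda>z. h (p z)) -` {c}) x = (\<Sum>b\<in>{b \<in> range p. h b = c}. E (p -` {b}) x)" for c
  proof -
    have "(\<lambda>z. h (p z)) -` {c} = (\<Union>b\<in>{b \<in> range p. h b = c}. p -` {b})" by auto
    then show ?thesis
      using p by (simp only:) (intro E_finite_UN, auto simp: disjoint_family_on_def)
  qed
  then have "S (\<lambda>z. h (p z)) x
      = (\<Sum>c\<in>h ` range p. \<Sum>b\<in>{b \<in> range p. h b = c}. h b *\<^sub>C E (p -` {b}) x)"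
    by (simp add: simple_spectral_integral_def scaleC_sum_right image_image)
  also have "\<dots> = (\<Sum>b\<in>range p. h b *\<^sub>C E (p -` {b}) x)"
    using p by (intro sum.image_gen[symmetric])
  finally show ?thesis .
qed

text \<open>The level sets of the pair are a common refinement for \<open>s\<close> and
  \<open>t\<close>: every pointwise combination becomes a sum over the same index set.\<close>

lemma simple_spectral_integral_combine:
  assumes "simple_function borel s" "simple_function borel t"
  shows "S (\<lambda>z. h (s z) (t z)) x
    = (\<Sum>b\<in>range (\<lambda>z. (s z, t z)). h (fst b) (snd b) *\<^sub>C E ((\<lambda>z. (s z, t z)) -` {b}) x)"
  using simple_spectral_integral_comp[OF simple_function_Pair[OF assms],
      where h = "\<lambda>b. h (fst b) (snd b)"] unfolding fst_conv snd_conv .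

lemma simple_spectral_integral_diff:
  assumes "simple_function borel s" "simple_function borel t"
  shows "S (\<lambda>z. s z - t z) x = S s x - S t x"
  unfolding simple_spectral_integral_combine[OF assms, of "\<lambda>c d. c - d"]
    simple_spectral_integral_combine[OF assms, of "\<lambda>c d. c"]
    simple_spectral_integral_combine[OF assms, of "\<lambda>c d. d"]
  by (simp only: sum_subtractf scaleC_diff_left)

lemma simple_spectral_integral_mult:
  assumes s: "simple_function borel s" and t: "simple_function borel t"
  shows "S (\<lambda>z. s z * t z) x = S s (S t x)"
proof -
  let ?p = "\<lambda>z. (s z, t z)"
  have s': "finite (range s)" "\<And>c. s -` {c} \<in> sets borel"
    and t': "finite (range t)" "\<And>c. t -` {c} \<in> sets borel"
    using s t unfolding simple_function_borel_iff by blast+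
  have "S s (S t x) = (\<Sum>c\<in>range s. \<Sum>d\<in>range t. (c * d) *\<^sub>C E (?p -` {(c, d)}) x)"
  proof -
    have "?p -` {(c, d)} = s -` {c} \<inter> t -` {d}" for c d by auto
    then show ?thesis
      unfolding simple_spectral_integral_def
      by (simp add: linear_sum[OF bounded_linear.linear[OF bounded_linear_E]] E_scaleC
          scaleC_sum_right scaleC_scaleC s' t' E_Int)
  qed
  also have "\<dots> = (\<Sum>b\<in>range s \<times> range t. (fst b * snd b) *\<^sub>C E (?p -` {b}) x)"
    by (simp add: sum.cartesian_product case_prod_unfold)
  \<comment> \<open>Pairs of values that are never attained together have empty preimage and
    contribute 0.\<close>
  also have "\<dots> = (\<Sum>b\<in>range ?p. (fst b * snd b) *\<^sub>C E (?p -` {b}) x)"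
  proof (intro sum.mono_neutral_right ballI)
    fix b assume "b \<in> range s \<times> range t - range ?p"
    then have "?p -` {b} = {}" by blast
    then show "(fst b * snd b) *\<^sub>C E (?p -` {b}) x = 0" by (simp add: E_empty)
  qed (use s' t' in auto)
  also have "\<dots> = S (\<lambda>z. s z * t z) x"
    using simple_spectral_integral_combine[OF s t, of "(*)"] by simp
  finally show ?thesis ..
qed

lemma simple_spectral_integral_const: "S (\<lambda>_. c) x = c *\<^sub>C x"
  by (simp add: simple_spectral_integral_def E_UNIV vimage_def)

lemma simple_spectral_integral_indicator:
  "S (indicator B) x = E B x"
proof -
  let ?f = "\<lambda>c. c *\<^sub>C E (indicator B -` {c}) x"
  \<comment> \<open>If \<open>B\<close> is empty or everything, one of the two values is missing
    from the range; its term is 0.\<close>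
  have "S (indicator B) x = sum ?f {0, 1}"
    unfolding simple_spectral_integral_def
  proof (intro sum.mono_neutral_left ballI)
    fix c :: complex assume "c \<in> {0, 1} - range (indicator B)"
    then have "indicator B -` {c} = {}" by auto
    then show "?f c = 0" by (simp add: E_empty)
  qed (auto simp: indicator_def)
  also have "\<dots> = E ((indicator B :: complex \<Rightarrow> complex) -` {1}) x" by simp
  also have "(indicator B :: complex \<Rightarrow> complex) -` {1} = B" by (auto simp: indicator_def)
  finally show ?thesis .
qed

lemma bounded_linear_simple_spectral_integral:
  assumes "simple_function borel s"
  shows "bounded_linear (S s)"
  unfolding simple_spectral_integral_def
  using assms
  by (intro bounded_linear_sum bounded_linear_compose[OF bounded_linear_scaleC] bounded_linear_E)
    (auto simp: simple_function_borel_iff)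

lemma simple_spectral_integral_scaleC:
  assumes "simple_function borel s"
  shows "S s (c *\<^sub>C x) = c *\<^sub>C S s x"
  using assms
  by (simp add: simple_spectral_integral_def E_scaleC scaleC_sum_right scaleC_scaleC mult.commute
      simple_function_borel_iff)

text \<open>Distinct level sets are disjoint, so their projections have orthogonal ranges and
  Pythagoras applies. All later norm computations are limits of this isometry.\<close>

lemma norm_simple_spectral_integral:
  assumes "simple_function borel s"
  shows "ennreal ((norm (S s x))\<^sup>2) = sq x s"
proof -
  have s: "finite (range s)" "\<And>c. s -` {c} \<in> sets borel"
    using assms unfolding simple_function_borel_iff by blast+
  have "(norm (S s x))\<^sup>2 = (\<Sum>c\<in>range s. (norm (c *\<^sub>C E (s -` {c}) x))\<^sup>2)"
    unfolding simple_spectral_integral_def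
  proof (intro norm_sum_Pythagorean pairwiseI)
    fix c d :: complex assume "c \<noteq> d"
    then have "s -` {c} \<inter> s -` {d} = {}" by auto
    then show "orthogonal (c *\<^sub>C E (s -` {c}) x) (d *\<^sub>C E (s -` {d}) x)"
      using s unfolding orthogonal_def by (intro inner_scaleC_scaleC_eq_0 cinner_E_disjoint)
  qed fact
  then have "ennreal ((norm (S s x))\<^sup>2)
      = (\<Sum>c\<in>range s. ennreal ((cmod c)\<^sup>2) * emeasure (\<mu> x) (s -` {c}))"
    using s by (simp add: emeasure_scalar_spectral_measure norm_scaleC power_mult_distrib
        sum_ennreal[symmetric] ennreal_mult)
  also have "\<dots> = (\<Sum>c\<in>range s. \<integral>\<^sup>+z. ennreal ((cmod c)\<^sup>2) * indicator (s -` {c}) z \<partial>\<mu> x)"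
    using s by (simp add: nn_integral_cmult_indicator)
  also have "\<dots> = (\<integral>\<^sup>+z. (\<Sum>c\<in>range s. ennreal ((cmod c)\<^sup>2) * indicator (s -` {c}) z) \<partial>\<mu> x)"
    using s by (intro nn_integral_sum[symmetric]) auto
  also have "\<dots> = sq x s"
  proof (intro nn_integral_cong)
    fix z
    have "(\<Sum>c\<in>range s. ennreal ((cmod c)\<^sup>2) * indicator (s -` {c}) z)
        = (\<Sum>c\<in>range s. if c = s z then ennreal ((cmod c)\<^sup>2) else 0)"
      by (intro sum.cong) (auto simp: indicator_def)
    then show "(\<Sum>c\<in>range s. ennreal ((cmod c)\<^sup>2) * indicator (s -` {c}) z)
        = ennreal ((cmod (s z))\<^sup>2)"
      using s by simp
  qed
  finally show ?thesis .
qed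

end

section \<open>Spectral integrals of Borel functions\<close>

text \<open>Young's inequality for the mixed term, from expanding the square of \<delta>|a| -
  |b|.\<close>

lemma cmod_add_squared_le:
  assumes "\<delta> > 0"
  shows "(cmod (a + b))\<^sup>2 \<le> (1 + \<delta>) * (cmod a)\<^sup>2 + (1 + 1 / \<delta>) * (cmod b)\<^sup>2"
proof -
  have "(cmod (a + b))\<^sup>2 \<le> (cmod a + cmod b)\<^sup>2"
    by (intro power_mono norm_triangle_ineq) auto
  moreover have "(\<delta> * cmod a - cmod b)\<^sup>2 / \<delta>
      = \<delta> * (cmod a)\<^sup>2 + (cmod b)\<^sup>2 / \<delta> - 2 * cmod a * cmod b"
    using assms by (simp add: power2_eq_square field_simps)
  moreover have "0 \<le> (\<delta> * cmod a - cmod b)\<^sup>2 / \<delta>"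
    using assms by simp
  ultimately show ?thesis
    by (simp add: power2_sum distrib_right)
qed

lemma ennreal_le_of_le_mult:
  assumes "\<And>\<delta>. \<delta> > 0 \<Longrightarrow> a \<le> ennreal (1 + \<delta>) * b"
  shows "a \<le> b"
proof (cases b)
  case (real r)
  have "(\<lambda>n. ennreal ((1 + 1 / real (Suc n)) * r)) \<longlonglongrightarrow> ennreal ((1 + 0) * r)"
    by (intro tendsto_ennrealI tendsto_mult tendsto_add tendsto_const LIMSEQ_Suc[OF lim_1_over_n])
  moreover have "a \<le> ennreal ((1 + 1 / real (Suc n)) * r)" for n
    using assms[of "1 / real (Suc n)"] real by (simp add: ennreal_mult)
  ultimately show ?thesis
    using real by (auto intro: LIMSEQ_le_const)
qed auto

lemma borel_measurable_simple_borel [measurable_dest]: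
  "simple_function borel s \<Longrightarrow> s \<in> borel_measurable (borel :: complex measure)"
  for s :: "complex \<Rightarrow> complex"
  by (rule borel_measurable_simple_function)

text \<open>The factor 2 comes from the library approximation relative to the base point 0; the
  bound supplies the dominating function below.\<close>

lemma simple_function_approximation:
  fixes f :: "complex \<Rightarrow> complex"
  assumes "f \<in> borel_measurable borel"
  obtains s where "\<And>n. simple_function borel (s n)" "\<And>z. (\<lambda>n. s n z) \<longlonglongrightarrow> f z"
    "\<And>n z. cmod (s n z) \<le> 2 * cmod (f z)"
proof -
  from borel_measurable_implies_sequence_metric[OF assms, of 0]
  obtain s where s: "(\<forall>i. simple_function borel (s i))
    \<and> (\<forall>z\<in>space borel. (\<lambda>i. s i z) \<longlonglongrightarrow> f z)
    \<and> (\<forall>i. \<forall>z\<in>space borel. dist (s i z) 0 \<le> 2 * dist (f z) 0)" ..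
  show ?thesis
  proof (rule that)
    fix n z
    show "simple_function borel (s n)" using s by blast
    show "(\<lambda>n. s n z) \<longlonglongrightarrow> f z" using s unfolding space_borel by blast
    show "cmod (s n z) \<le> 2 * cmod (f z)"
      using s unfolding space_borel norm_conv_dist by blast
  qed
qed

context spectral_resolution
begin

lemma spectral_integralI:
  assumes "\<And>n. simple_function borel (s n)" "(\<lambda>n. sq x (\<lambda>z. f z - s n z)) \<longlonglongrightarrow> 0"
    "(\<lambda>n. S (s n) x) \<longlonglongrightarrow> y"
  shows "(x, y) \<in> A f"
  unfolding spectral_integral_def mem_Collect_eq case_prod_conv
  using assms by (intro exI[of _ s] conjI allI)

text \<open>Minkowski's inequality is replaced by this one throughout, which stays in \<^typ>\<open>ennreal\<close>; the optimal
  constant is recovered by letting \<open>\<delta>\<close> tend to \<open>0\<close>.\<close>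

lemma sq_add:
  assumes [measurable]: "f \<in> borel_measurable borel" "g \<in> borel_measurable borel"
    and \<delta>: "\<delta> > 0"
  shows "sq x (\<lambda>z. f z + g z) \<le> ennreal (1 + \<delta>) * sq x f + ennreal (1 + 1 / \<delta>) * sq x g"
proof -
  have "sq x (\<lambda>z. f z + g z) \<le> (\<integral>\<^sup>+z. ennreal (1 + \<delta>) * ennreal ((cmod (f z))\<^sup>2)
      + ennreal (1 + 1 / \<delta>) * ennreal ((cmod (g z))\<^sup>2) \<partial>\<mu> x)"
    using cmod_add_squared_le[OF \<delta>] \<delta>
    by (intro nn_integral_mono) (simp add: ennreal_mult[symmetric] ennreal_plus[symmetric]
        ennreal_leI del: ennreal_plus)
  also have "\<dots> = ennreal (1 + \<delta>) * sq x f + ennreal (1 + 1 / \<delta>) * sq x g"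
    by (simp add: nn_integral_add nn_integral_cmult)
  finally show ?thesis .
qed

lemma sq_uminus: "sq x (\<lambda>z. - f z) = sq x f"
  by simp

lemma sq_diff:
  assumes [measurable]: "f \<in> borel_measurable borel" "g \<in> borel_measurable borel"
  shows "sq x (\<lambda>z. f z - g z) \<le> 2 * sq x f + 2 * sq x g"
  using sq_add[of f "\<lambda>z. - g z" 1 x] by simp

lemma sq_const: "sq x (\<lambda>_. c) = ennreal ((cmod c * norm x)\<^sup>2)"
  by (simp add: emeasure_scalar_spectral_measure E_UNIV ennreal_mult power_mult_distrib)

text \<open>The isometry survives the limit: \<open>sq_add\<close> compares \<open>f\<close> with
  \<open>s n\<close> in both directions, the error term vanishes, and then \<delta> tends to 0. In
  particular every \<open>x\<close> in the domain has finite \<open>sq x f\<close>.\<close>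

lemma spectral_integral_norm:
  assumes f [measurable]: "f \<in> borel_measurable borel" and xy: "(x, y) \<in> A f"
  shows "sq x f = ennreal ((norm y)\<^sup>2)"
proof -
  obtain s where s: "\<And>n. simple_function borel (s n)"
    and lim: "(\<lambda>n. sq x (\<lambda>z. f z - s n z)) \<longlonglongrightarrow> 0" "(\<lambda>n. S (s n) x) \<longlonglongrightarrow> y"
    using xy unfolding spectral_integral_def by auto
  have [measurable]: "s n \<in> borel_measurable borel" for n
    using s by (rule borel_measurable_simple_borel)
  have norm: "(\<lambda>n. sq x (s n)) \<longlonglongrightarrow> ennreal ((norm y)\<^sup>2)"
    using lim(2) by (subst norm_simple_spectral_integral[OF s, symmetric])
      (intro tendsto_ennrealI tendsto_power tendsto_norm)
  have *: "(\<lambda>n. c + ennreal (1 + 1 / \<delta>) * sq x (\<lambda>z. f z - s n z)) \<longlonglongrightarrow> c"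
    for \<delta> :: real and c
    using tendsto_add[OF tendsto_const ennreal_tendsto_cmult[OF _ lim(1)], of "ennreal (1 + 1 / \<delta>)" c]
    by simp
  show ?thesis
  proof (rule antisym; rule ennreal_le_of_le_mult)
    fix \<delta> :: real assume \<delta>: "\<delta> > 0"
    have "sq x f \<le> ennreal (1 + \<delta>) * sq x (s n)
        + ennreal (1 + 1 / \<delta>) * sq x (\<lambda>z. f z - s n z)" for n
      using sq_add[of "s n" "\<lambda>z. f z - s n z" \<delta> x, OF _ _ \<delta>] by simp
    moreover have "(\<lambda>n. ennreal (1 + \<delta>) * sq x (s n)
        + ennreal (1 + 1 / \<delta>) * sq x (\<lambda>z. f z - s n z))
      \<longlonglongrightarrow> ennreal (1 + \<delta>) * ennreal ((norm y)\<^sup>2) + 0"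
      using *[of 0 \<delta>] norm by (intro tendsto_add ennreal_tendsto_cmult) auto
    ultimately show "sq x f \<le> ennreal (1 + \<delta>) * ennreal ((norm y)\<^sup>2)"
      by (auto intro: LIMSEQ_le_const)
  next
    fix \<delta> :: real assume \<delta>: "\<delta> > 0"
    have "sq x (s n) \<le> ennreal (1 + \<delta>) * sq x f
        + ennreal (1 + 1 / \<delta>) * sq x (\<lambda>z. f z - s n z)" for n
      using sq_add[of f "\<lambda>z. - (f z - s n z)" \<delta> x, OF _ _ \<delta>] unfolding sq_uminus by simp
    then show "ennreal ((norm y)\<^sup>2) \<le> ennreal (1 + \<delta>) * sq x f"
      by (intro LIMSEQ_le[OF norm *]) auto
  qed
qed

lemma sq_diff_tendsto_0:
  assumes "\<And>n. u n \<in> borel_measurable borel" "\<And>n. v n \<in> borel_measurable borel"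
    and lim: "(\<lambda>n. sq x (u n)) \<longlonglongrightarrow> 0" "(\<lambda>n. sq x (v n)) \<longlonglongrightarrow> 0"
  shows "(\<lambda>n. sq x (\<lambda>z. u n z - v n z)) \<longlonglongrightarrow> 0"
proof (rule tendsto_sandwich[OF always_eventually always_eventually tendsto_const])
  show "(\<lambda>n. 2 * sq x (u n) + 2 * sq x (v n)) \<longlonglongrightarrow> 0"
    using tendsto_add[OF ennreal_tendsto_cmult[OF _ lim(1)] ennreal_tendsto_cmult[OF _ lim(2)],
        of 2 2] by (simp add: less_top[symmetric])
qed (use assms sq_diff in auto)

lemma spectral_integral_diff:
  assumes f [measurable]: "f \<in> borel_measurable borel" and g [measurable]: "g \<in> borel_measurable borel"
    and "(x, y) \<in> A f" "(x, y') \<in> A g"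
  shows "(x, y - y') \<in> A (\<lambda>z. f z - g z)"
proof -
  obtain s where s: "\<And>n. simple_function borel (s n)"
    "(\<lambda>n. sq x (\<lambda>z. f z - s n z)) \<longlonglongrightarrow> 0" "(\<lambda>n. S (s n) x) \<longlonglongrightarrow> y"
    using assms(3) unfolding spectral_integral_def by auto
  obtain t where t: "\<And>n. simple_function borel (t n)"
    "(\<lambda>n. sq x (\<lambda>z. g z - t n z)) \<longlonglongrightarrow> 0" "(\<lambda>n. S (t n) x) \<longlonglongrightarrow> y'"
    using assms(4) unfolding spectral_integral_def by auto
  have [measurable]: "s n \<in> borel_measurable borel" "t n \<in> borel_measurable borel" for n
    using s t by (auto intro: borel_measurable_simple_borel)
  have "(\<lambda>n. sq x (\<lambda>z. (f z - s n z) - (g z - t n z))) \<longlonglongrightarrow> 0"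
    using s(2) t(2)
    by (intro sq_diff_tendsto_0[where u = "\<lambda>n z. f z - s n z" and v = "\<lambda>n z. g z - t n z"]) auto
  then have "(\<lambda>n. sq x (\<lambda>z. (f z - g z) - (s n z - t n z))) \<longlonglongrightarrow> 0"
    by (simp add: algebra_simps)
  moreover have "(\<lambda>n. S (\<lambda>z. s n z - t n z) x) \<longlonglongrightarrow> y - y'"
    unfolding simple_spectral_integral_diff[OF s(1) t(1)] using s(3) t(3) by (rule tendsto_diff)
  moreover have "simple_function borel (\<lambda>z. s n z - t n z)" for n
    using s(1) t(1) by (rule simple_function_diff)
  ultimately show ?thesis
    by (intro spectral_integralI[where s = "\<lambda>n z. s n z - t n z"])
qed

text \<open>The main device for identifying values: two integrals at the same vector agree once
  their integrands agree almost everywhere.\<close>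

lemma spectral_integral_dist:
  assumes "f \<in> borel_measurable borel" "g \<in> borel_measurable borel"
    and "(x, y) \<in> A f" "(x, y') \<in> A g"
  shows "sq x (\<lambda>z. f z - g z) = ennreal ((norm (y - y'))\<^sup>2)"
  using assms by (intro spectral_integral_norm spectral_integral_diff) auto

lemma spectral_integral_unique:
  assumes "f \<in> borel_measurable borel" "(x, y) \<in> A f" "(x, y') \<in> A f"
  shows "y = y'"
  using spectral_integral_dist[OF assms(1,1,2,3)] by simp

text \<open>Completeness of the space is used here: by the isometry, convergence of the simple
  functions in mean square makes their integrals at \<open>x\<close> a Cauchy sequence.\<close>

lemma simple_spectral_integral_convergent:
  assumes f [measurable]: "f \<in> borel_measurable borel" and s: "\<And>n. simple_function borel (s n)"
    and lim: "(\<lambda>n. sq x (\<lambda>z. f z - s n z)) \<longlonglongrightarrow> 0"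
  obtains y where "(\<lambda>n. S (s n) x) \<longlonglongrightarrow> y" "(x, y) \<in> A f"
proof -
  have [measurable]: "s n \<in> borel_measurable borel" for n
    using s by (rule borel_measurable_simple_borel)
  have "Cauchy (\<lambda>n. S (s n) x)"
  proof (rule CauchyI)
    fix e :: real assume e: "0 < e"
    \<comment> \<open>With the constants 2 of \<open>sq_diff\<close>, the bound
      \<open>e\<^sup>2 / 8\<close> adds up to \<open>e\<^sup>2 / 2\<close>, strictly below
      \<open>e\<^sup>2\<close>.\<close>
    have "eventually (\<lambda>n. sq x (\<lambda>z. f z - s n z) < ennreal (e\<^sup>2 / 8)) sequentially"
      using lim e by (intro order_tendstoD(2)[OF lim]) simp
    then obtain M where M: "\<And>n. n \<ge> M \<Longrightarrow> sq x (\<lambda>z. f z - s n z) < ennreal (e\<^sup>2 / 8)"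
      by (auto simp: eventually_sequentially)
    have "norm (S (s m) x - S (s n) x) < e" if "m \<ge> M" "n \<ge> M" for m n
    proof -
      have "ennreal ((norm (S (s m) x - S (s n) x))\<^sup>2) = sq x (\<lambda>z. s m z - s n z)"
        using s by (simp add: simple_spectral_integral_diff[symmetric] norm_simple_spectral_integral)
      also have "\<dots> = sq x (\<lambda>z. (f z - s n z) - (f z - s m z))"
        by (simp add: algebra_simps)
      also have "\<dots> \<le> 2 * sq x (\<lambda>z. f z - s n z) + 2 * sq x (\<lambda>z. f z - s m z)"
        by (intro sq_diff) auto
      also have "\<dots> \<le> 2 * ennreal (e\<^sup>2 / 8) + 2 * ennreal (e\<^sup>2 / 8)"
        using M[OF that(1)] M[OF that(2)] by (intro add_mono mult_left_mono) (auto simp: less_imp_le)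
      also have "\<dots> = ennreal (e\<^sup>2 / 2)"
        using e by (simp add: ennreal_mult[symmetric] ennreal_plus[symmetric] numeral_mult_ennreal
            del: ennreal_plus)
      finally have "(norm (S (s m) x - S (s n) x))\<^sup>2 \<le> e\<^sup>2 / 2"
        using e by (subst (asm) ennreal_le_iff) auto
      also have "\<dots> < e\<^sup>2" using e by simp
      finally show ?thesis
        using e by (simp add: power2_less_imp_less)
    qed
    then show "\<exists>M. \<forall>m\<ge>M. \<forall>n\<ge>M. norm (S (s m) x - S (s n) x) < e" by blast
  qed
  then have "convergent (\<lambda>n. S (s n) x)"
    by (rule Cauchy_convergent)
  then obtain y where "(\<lambda>n. S (s n) x) \<longlonglongrightarrow> y"
    unfolding convergent_def ..
  moreover from this have "(x, y) \<in> A f"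
    by (rule spectral_integralI[OF s lim])
  ultimately show ?thesis by (rule that)
qed

text \<open>Dominated convergence: |f - s| is at most 3|f|, whence the factor 9. The weight
  \<open>h\<close> is 1 for the existence of values and the inner integrand for products.\<close>

lemma sq_approximation_tendsto_0:
  assumes [measurable]: "f \<in> borel_measurable borel" "h \<in> borel_measurable borel"
    and s: "\<And>n. simple_function borel (s n)" "\<And>z. (\<lambda>n. s n z) \<longlonglongrightarrow> f z"
      "\<And>n z. cmod (s n z) \<le> 2 * cmod (f z)"
    and fin: "sq x (\<lambda>z. f z * h z) < \<infinity>"
  shows "(\<lambda>n. sq x (\<lambda>z. (f z - s n z) * h z)) \<longlonglongrightarrow> 0"
proof -
  have [measurable]: "s n \<in> borel_measurable borel" for n
    using s(1) by (rule borel_measurable_simple_borel)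
  have "(\<lambda>n. sq x (\<lambda>z. (f z - s n z) * h z)) \<longlonglongrightarrow> (\<integral>\<^sup>+z. 0 \<partial>\<mu> x)"
  proof (rule nn_integral_dominated_convergence[where w = "\<lambda>z. 9 * ennreal ((cmod (f z * h z))\<^sup>2)"])
    fix n
    have "(cmod ((f z - s n z) * h z))\<^sup>2 \<le> 9 * (cmod (f z * h z))\<^sup>2" for z
    proof -
      have "cmod (f z - s n z) \<le> 3 * cmod (f z)"
        using norm_triangle_ineq4[of "f z" "s n z"] s(3)[of n z] by linarith
      then have "cmod ((f z - s n z) * h z) \<le> 3 * cmod (f z * h z)"
        by (simp add: norm_mult mult_right_mono flip: mult.assoc)
      then have "(cmod ((f z - s n z) * h z))\<^sup>2 \<le> (3 * cmod (f z * h z))\<^sup>2"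
        by (rule power_mono) simp
      then show ?thesis by (simp add: power_mult_distrib)
    qed
    then have "ennreal ((cmod ((f z - s n z) * h z))\<^sup>2) \<le> ennreal (9 * (cmod (f z * h z))\<^sup>2)" for z
      by (rule ennreal_leI)
    then show "AE z in \<mu> x. ennreal ((cmod ((f z - s n z) * h z))\<^sup>2)
        \<le> 9 * ennreal ((cmod (f z * h z))\<^sup>2)"
      by (simp add: numeral_mult_ennreal)
  next
    have "(\<lambda>n. ennreal ((cmod ((f z - s n z) * h z))\<^sup>2)) \<longlonglongrightarrow> ennreal ((cmod ((f z - f z) * h z))\<^sup>2)"
      for z by (intro tendsto_intros s(2))
    then show "AE z in \<mu> x. (\<lambda>n. ennreal ((cmod ((f z - s n z) * h z))\<^sup>2)) \<longlonglongrightarrow> 0"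
      by simp
  next
    show "(\<integral>\<^sup>+z. 9 * ennreal ((cmod (f z * h z))\<^sup>2) \<partial>\<mu> x) < \<infinity>"
      using fin by (simp add: nn_integral_cmult ennreal_mult_less_top)
  qed measurable
  then show ?thesis by simp
qed

lemma spectral_integral_approximation:
  assumes f: "f \<in> borel_measurable borel"
    and s: "\<And>n. simple_function borel (s n)" "\<And>z. (\<lambda>n. s n z) \<longlonglongrightarrow> f z"
      "\<And>n z. cmod (s n z) \<le> 2 * cmod (f z)"
    and fin: "sq x f < \<infinity>"
  obtains y where "(\<lambda>n. S (s n) x) \<longlonglongrightarrow> y" "(x, y) \<in> A f"
proof (rule simple_spectral_integral_convergent[OF f s(1)])
  show "(\<lambda>n. sq x (\<lambda>z. f z - s n z)) \<longlonglongrightarrow> 0"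
    using sq_approximation_tendsto_0[where h = "\<lambda>_. 1", OF f _ s] fin by simp
qed (rule that)

text \<open>The graph lets the sequence vary with the vector; by uniqueness one fixed approximation
  of \<open>f\<close> computes the value at every vector of the domain. This is what makes linearity
  in \<open>x\<close> accessible.\<close>

lemma spectral_integral_approximation_limit:
  assumes f: "f \<in> borel_measurable borel"
    and s: "\<And>n. simple_function borel (s n)" "\<And>z. (\<lambda>n. s n z) \<longlonglongrightarrow> f z"
      "\<And>n z. cmod (s n z) \<le> 2 * cmod (f z)"
    and xy: "(x, y) \<in> A f"
  shows "(\<lambda>n. S (s n) x) \<longlonglongrightarrow> y"
proof -
  have "sq x f < \<infinity>"
    using spectral_integral_norm[OF f xy] by simp
  then obtain y' where y': "(\<lambda>n. S (s n) x) \<longlonglongrightarrow> y'" "(x, y') \<in> A f"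
    by (rule spectral_integral_approximation[OF f s])
  then show ?thesis
    using y' spectral_integral_unique[OF f y'(2) xy] by simp
qed

lemma spectral_integral_exists:
  assumes f: "f \<in> borel_measurable borel" and fin: "sq x f < \<infinity>"
  obtains y where "(x, y) \<in> A f"
proof -
  obtain s where s: "\<And>n. simple_function borel (s n)" "\<And>z. (\<lambda>n. s n z) \<longlonglongrightarrow> f z"
    "\<And>n z. cmod (s n z) \<le> 2 * cmod (f z)"
    by (rule simple_function_approximation[OF f]) (rule that)
  show ?thesis
    by (rule spectral_integral_approximation[OF f s fin]) (rule that)
qed

text \<open>By Fatou's lemma. It shows that domains are linear subspaces without comparing the measures
  of \<open>x\<close>, \<open>x'\<close> and \<open>x + x'\<close>.\<close>

lemma sq_finite_of_bounded_approximation: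
  assumes f [measurable]: "f \<in> borel_measurable borel"
    and s: "\<And>n. simple_function borel (s n)" "\<And>z. (\<lambda>n. s n z) \<longlonglongrightarrow> f z"
    and le: "\<And>n. sq x (s n) \<le> K" and K: "K < \<infinity>"
  shows "sq x f < \<infinity>"
proof -
  have [measurable]: "s n \<in> borel_measurable borel" for n
    using s(1) by (rule borel_measurable_simple_borel)
  have "liminf (\<lambda>n. ennreal ((cmod (s n z))\<^sup>2)) = ennreal ((cmod (f z))\<^sup>2)" for z
    by (rule lim_imp_Liminf[OF _ tendsto_ennrealI[OF tendsto_power[OF tendsto_norm[OF s(2)]]]]) simp
  then have "sq x f = (\<integral>\<^sup>+z. liminf (\<lambda>n. ennreal ((cmod (s n z))\<^sup>2)) \<partial>\<mu> x)"
    by simp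
  also have "\<dots> \<le> liminf (\<lambda>n. sq x (s n))"
    by (intro nn_integral_liminf) measurable
  also have "\<dots> \<le> limsup (\<lambda>n. sq x (s n))"
    by (rule Liminf_le_Limsup) simp
  also have "\<dots> \<le> K"
    by (rule Limsup_bounded) (simp add: le)
  finally show ?thesis using K by simp
qed

lemma sq_approximation_le:
  assumes "\<And>n z. cmod (s n z) \<le> 2 * cmod (f z)" "f \<in> borel_measurable borel"
  shows "sq x (s n) \<le> 4 * sq x f"
proof -
  have "(cmod (s n z))\<^sup>2 \<le> 4 * (cmod (f z))\<^sup>2" for z
    using power_mono[OF assms(1)[of n z], of 2] by (simp add: power_mult_distrib)
  then have "ennreal ((cmod (s n z))\<^sup>2) \<le> ennreal (4 * (cmod (f z))\<^sup>2)" for z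
    by (rule ennreal_leI)
  then have "sq x (s n) \<le> (\<integral>\<^sup>+z. 4 * ennreal ((cmod (f z))\<^sup>2) \<partial>\<mu> x)"
    by (intro nn_integral_mono) (simp add: numeral_mult_ennreal)
  then show ?thesis using assms(2) by (simp add: nn_integral_cmult)
qed

text \<open>One sequence \<open>s\<close> serves all three vectors. Additivity of
  \<open>S (s n)\<close> bounds \<open>sq (x + x') (s n)\<close> uniformly, Fatou then puts
  \<open>x + x'\<close> into the domain, and the limits add up.\<close>

lemma spectral_integral_add:
  assumes f [measurable]: "f \<in> borel_measurable borel" and "(x, y) \<in> A f" "(x', y') \<in> A f"
  shows "(x + x', y + y') \<in> A f"
proof -
  obtain s where s: "\<And>n. simple_function borel (s n)" "\<And>z. (\<lambda>n. s n z) \<longlonglongrightarrow> f z"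
    "\<And>n z. cmod (s n z) \<le> 2 * cmod (f z)"
    by (rule simple_function_approximation[OF f]) (rule that)
  have fin: "sq x f < \<infinity>" "sq x' f < \<infinity>"
    using assms by (simp_all add: spectral_integral_norm)
  have lin: "S (s n) (x + x') = S (s n) x + S (s n) x'" for n
    using bounded_linear_simple_spectral_integral[OF s(1)]
    by (intro linear_add bounded_linear.linear)
  have lim: "(\<lambda>n. S (s n) x) \<longlonglongrightarrow> y" "(\<lambda>n. S (s n) x') \<longlonglongrightarrow> y'"
    by (rule spectral_integral_approximation_limit[OF f s], fact)+
  have "sq (x + x') (s n) \<le> 2 * (4 * sq x f) + 2 * (4 * sq x' f)" for n
  proof -
    have "(norm (S (s n) x + S (s n) x'))\<^sup>2 \<le> 2 * (norm (S (s n) x))\<^sup>2 + 2 * (norm (S (s n) x'))\<^sup>2"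
    proof -
      have "(norm (S (s n) x + S (s n) x'))\<^sup>2 \<le> (norm (S (s n) x) + norm (S (s n) x'))\<^sup>2"
        by (intro power_mono norm_triangle_ineq) auto
      also have "\<dots> \<le> 2 * (norm (S (s n) x))\<^sup>2 + 2 * (norm (S (s n) x'))\<^sup>2"
        using sum_squares_bound[of "norm (S (s n) x)" "norm (S (s n) x')"]
        by (simp add: power2_sum)
      finally show ?thesis .
    qed
    then have "sq (x + x') (s n) \<le> 2 * sq x (s n) + 2 * sq x' (s n)"
      by (simp add: norm_simple_spectral_integral[OF s(1), symmetric] lin numeral_mult_ennreal
          ennreal_plus[symmetric] ennreal_leI del: ennreal_plus)
    also have "\<dots> \<le> 2 * (4 * sq x f) + 2 * (4 * sq x' f)"
      using s(3) f by (intro add_mono mult_left_mono sq_approximation_le) auto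
    finally show ?thesis .
  qed
  moreover have "2 * (4 * sq x f) + 2 * (4 * sq x' f) < \<infinity>"
    using fin by (simp add: ennreal_mult_less_top)
  ultimately have "sq (x + x') f < \<infinity>"
    by (rule sq_finite_of_bounded_approximation[OF f s(1,2)])
  then obtain v where v: "(\<lambda>n. S (s n) (x + x')) \<longlonglongrightarrow> v" "(x + x', v) \<in> A f"
    by (rule spectral_integral_approximation[OF f s])
  have "v = y + y'"
    using v(1) tendsto_add[OF lim] unfolding lin by (rule LIMSEQ_unique)
  then show ?thesis using v by simp
qed

lemma spectral_integral_scaleC:
  assumes f [measurable]: "f \<in> borel_measurable borel" and "(x, y) \<in> A f"
  shows "(c *\<^sub>C x, c *\<^sub>C y) \<in> A f"
proof -
  obtain s where s: "\<And>n. simple_function borel (s n)" "\<And>z. (\<lambda>n. s n z) \<longlonglongrightarrow> f z"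
    "\<And>n z. cmod (s n z) \<le> 2 * cmod (f z)"
    by (rule simple_function_approximation[OF f]) (rule that)
  have fin: "sq x f < \<infinity>"
    using assms by (simp add: spectral_integral_norm)
  have lim: "(\<lambda>n. S (s n) x) \<longlonglongrightarrow> y"
    by (rule spectral_integral_approximation_limit[OF f s]) fact
  have "sq (c *\<^sub>C x) (s n) \<le> ennreal ((cmod c)\<^sup>2) * (4 * sq x f)" for n
  proof -
    have "sq (c *\<^sub>C x) (s n) = ennreal ((cmod c)\<^sup>2) * sq x (s n)"
      unfolding norm_simple_spectral_integral[OF s(1), symmetric]
        simple_spectral_integral_scaleC[OF s(1)] norm_scaleC power_mult_distrib
      by (rule ennreal_mult) auto
    also have "\<dots> \<le> ennreal ((cmod c)\<^sup>2) * (4 * sq x f)"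
      using s(3) f by (intro mult_left_mono sq_approximation_le) auto
    finally show ?thesis .
  qed
  moreover have "ennreal ((cmod c)\<^sup>2) * (4 * sq x f) < \<infinity>"
    using fin by (simp add: ennreal_mult_less_top)
  ultimately have "sq (c *\<^sub>C x) f < \<infinity>"
    by (rule sq_finite_of_bounded_approximation[OF f s(1,2)])
  then obtain v where v: "(\<lambda>n. S (s n) (c *\<^sub>C x)) \<longlonglongrightarrow> v" "(c *\<^sub>C x, v) \<in> A f"
    by (rule spectral_integral_approximation[OF f s])
  have "v = c *\<^sub>C y"
    using v(1) tendsto_scaleC[OF lim, of c]
    unfolding simple_spectral_integral_scaleC[OF s(1)] by (rule LIMSEQ_unique)
  then show ?thesis using v by simp
qed

lemma spectral_integral_minus_arg:
  assumes "f \<in> borel_measurable borel" "(x, y) \<in> A f" "(x', y') \<in> A f"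
  shows "(x - x', y - y') \<in> A f"
  using spectral_integral_add[OF assms(1,2) spectral_integral_scaleC[OF assms(1,3), of "-1"]]
  by (simp add: scaleC_minus_left)

section \<open>Products of integrands\<close>

lemma spectral_integral_simple_mult:
  assumes s: "simple_function borel s" and g [measurable]: "g \<in> borel_measurable borel"
    and wx: "(w, x) \<in> A g"
  shows "(w, S s x) \<in> A (\<lambda>z. s z * g z)"
proof -
  have [measurable]: "s \<in> borel_measurable borel"
    using s by (rule borel_measurable_simple_borel)
  obtain t where t: "\<And>n. simple_function borel (t n)"
    and lim: "(\<lambda>n. sq w (\<lambda>z. g z - t n z)) \<longlonglongrightarrow> 0" "(\<lambda>n. S (t n) w) \<longlonglongrightarrow> x"
    using wx unfolding spectral_integral_def by auto
  have [measurable]: "t n \<in> borel_measurable borel" for n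
    using t by (rule borel_measurable_simple_borel)
  \<comment> \<open>A simple \<open>s\<close> is bounded, so multiplying by it preserves mean square
    convergence to \<open>g\<close>, while \<open>S s\<close> preserves convergence of the
    values.\<close>
  have "finite (range (\<lambda>z. cmod (s z)))"
    using s unfolding simple_function_borel_iff by (simp flip: image_image)
  then obtain M where M: "\<And>z. cmod (s z) \<le> M"
    using Max_ge by blast
  have "(\<lambda>n. sq w (\<lambda>z. s z * g z - s z * t n z)) \<longlonglongrightarrow> 0"
  proof (rule tendsto_sandwich[OF always_eventually always_eventually tendsto_const])
    show "(\<lambda>n. ennreal (M\<^sup>2) * sq w (\<lambda>z. g z - t n z)) \<longlonglongrightarrow> 0"
      using ennreal_tendsto_cmult[OF _ lim(1), of "ennreal (M\<^sup>2)"] by simp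
    show "\<forall>n. sq w (\<lambda>z. s z * g z - s z * t n z) \<le> ennreal (M\<^sup>2) * sq w (\<lambda>z. g z - t n z)"
    proof
      fix n
      have "(cmod (s z * g z - s z * t n z))\<^sup>2 \<le> M\<^sup>2 * (cmod (g z - t n z))\<^sup>2" for z
        using power_mono[OF M[of z], of 2]
        by (simp add: norm_mult power_mult_distrib mult_right_mono flip: right_diff_distrib)
      then have "sq w (\<lambda>z. s z * g z - s z * t n z)
          \<le> (\<integral>\<^sup>+z. ennreal (M\<^sup>2) * ennreal ((cmod (g z - t n z))\<^sup>2) \<partial>\<mu> w)"
        by (intro nn_integral_mono) (simp add: ennreal_leI flip: ennreal_mult)
      then show "sq w (\<lambda>z. s z * g z - s z * t n z) \<le> ennreal (M\<^sup>2) * sq w (\<lambda>z. g z - t n z)"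
        by (simp add: nn_integral_cmult)
    qed
  qed simp
  moreover have "(\<lambda>n. S (\<lambda>z. s z * t n z) w) \<longlonglongrightarrow> S s x"
    unfolding simple_spectral_integral_mult[OF s t]
    using lim(2) by (rule bounded_linear.tendsto[OF bounded_linear_simple_spectral_integral[OF s]])
  moreover have "simple_function borel (\<lambda>z. s z * t n z)" for n
    using s t by (rule simple_function_mult)
  ultimately show ?thesis
    by (intro spectral_integralI[where s = "\<lambda>n z. s z * t n z"])
qed

lemma spectral_integral_cmult:
  assumes "g \<in> borel_measurable borel" "(w, x) \<in> A g"
  shows "(w, c *\<^sub>C x) \<in> A (\<lambda>z. c * g z)"
  using spectral_integral_simple_mult[of "\<lambda>_. c", OF _ assms]
  by (simp add: simple_spectral_integral_const)

lemma spectral_integral_const: "(x, c *\<^sub>C x) \<in> A (\<lambda>_. c)"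
  by (rule spectral_integralI[where s = "\<lambda>_ _. c"]) (simp_all add: simple_spectral_integral_const)

text \<open>Change of measure: if \<open>x\<close> is the integral of \<open>g\<close> at
  \<open>w\<close>, the scalar measure of \<open>x\<close> has density |g| squared with respect to
  that of \<open>w\<close>. On a Borel set this is the isometry for \<open>g\<close> cut off by an
  indicator.\<close>

lemma sq_spectral_integral:
  assumes g [measurable]: "g \<in> borel_measurable borel" and wx: "(w, x) \<in> A g"
    and f [measurable]: "f \<in> borel_measurable borel"
  shows "sq x f = sq w (\<lambda>z. f z * g z)"
proof -
  have "\<mu> x = density (\<mu> w) (\<lambda>z. ennreal ((cmod (g z))\<^sup>2))"
  proof (rule measure_eqI)
    fix B assume "B \<in> sets (\<mu> x)"
    then have [measurable]: "B \<in> sets borel" by simp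
    have "(w, E B x) \<in> A (\<lambda>z. indicator B z * g z)"
      using spectral_integral_simple_mult[of "indicator B", OF _ g wx]
      by (simp add: simple_spectral_integral_indicator)
    then have "emeasure (\<mu> x) B = sq w (\<lambda>z. indicator B z * g z)"
      by (subst spectral_integral_norm) (auto simp: emeasure_scalar_spectral_measure)
    also have "\<dots> = emeasure (density (\<mu> w) (\<lambda>z. ennreal ((cmod (g z))\<^sup>2))) B"
      by (subst emeasure_density) (auto intro!: nn_integral_cong simp: indicator_def)
    finally show "emeasure (\<mu> x) B = emeasure (density (\<mu> w) (\<lambda>z. ennreal ((cmod (g z))\<^sup>2))) B" .
  qed simp
  then show ?thesis
    by (simp add: nn_integral_density norm_mult power_mult_distrib ennreal_mult mult.commute)
qed

text \<open>Finiteness at \<open>w\<close> places \<open>x\<close> in the domain of \<open>f\<close>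
  by change of measure. The value of \<open>f\<close> at \<open>x\<close> and that of the product at
  \<open>w\<close> are both limits of \<open>S (s n) x\<close>, hence equal.\<close>

lemma spectral_integral_mult:
  assumes g [measurable]: "g \<in> borel_measurable borel" and f [measurable]: "f \<in> borel_measurable borel"
    and wx: "(w, x) \<in> A g" and fin: "sq w (\<lambda>z. f z * g z) < \<infinity>"
  obtains y where "(x, y) \<in> A f" "(w, y) \<in> A (\<lambda>z. f z * g z)"
proof -
  obtain s where s: "\<And>n. simple_function borel (s n)" "\<And>z. (\<lambda>n. s n z) \<longlonglongrightarrow> f z"
    "\<And>n z. cmod (s n z) \<le> 2 * cmod (f z)"
    by (rule simple_function_approximation[OF f]) (rule that)
  have [measurable]: "s n \<in> borel_measurable borel" for n
    using s(1) by (rule borel_measurable_simple_borel)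
  have "sq x f < \<infinity>"
    using fin by (simp add: sq_spectral_integral[OF g wx f])
  then obtain y where y: "(\<lambda>n. S (s n) x) \<longlonglongrightarrow> y" "(x, y) \<in> A f"
    by (rule spectral_integral_approximation[OF f s])
  obtain y' where y': "(w, y') \<in> A (\<lambda>z. f z * g z)"
    by (rule spectral_integral_exists[OF _ fin]) measurable
  have "ennreal ((norm (y' - S (s n) x))\<^sup>2) = sq w (\<lambda>z. (f z - s n z) * g z)" for n
    using spectral_integral_dist[OF _ _ y' spectral_integral_simple_mult[OF s(1)[of n] g wx]]
    by (simp add: left_diff_distrib)
  then have "(\<lambda>n. ennreal ((norm (y' - S (s n) x))\<^sup>2)) \<longlonglongrightarrow> 0"
    using sq_approximation_tendsto_0[OF f g s fin] by simp
  then have "(\<lambda>n. norm (y' - S (s n) x)) \<longlonglongrightarrow> 0"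
    by (simp add: ennreal_tendsto_0_iff)
  then have "(\<lambda>n. y' - S (s n) x) \<longlonglongrightarrow> 0"
    by (rule tendsto_norm_zero_cancel)
  moreover have "(\<lambda>n. y' - S (s n) x) \<longlonglongrightarrow> y' - y"
    using y(1) by (intro tendsto_diff tendsto_const)
  ultimately have "y' = y"
    using LIMSEQ_unique by fastforce
  then show ?thesis using y(2) y' that by blast
qed

section \<open>Null sets and the resolvent set\<close>

lemma E_zero: "B \<in> sets borel \<Longrightarrow> E B 0 = 0"
  by (rule linear_0[OF bounded_linear.linear[OF bounded_linear_E]])

lemma E_mono_eq_0:
  assumes "B \<in> sets borel" "C \<in> sets borel" "B \<subseteq> C" "E C x = 0"
  shows "E B x = 0"
  using E_Int[of B C x] assms by (simp add: Int_absorb2 E_zero)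

lemma E_eq_0_iff_AE:
  assumes [measurable]: "B \<in> sets borel"
  shows "E B x = 0 \<longleftrightarrow> (AE z in \<mu> x. z \<notin> B)"
proof -
  have "(AE z in \<mu> x. z \<notin> B) \<longleftrightarrow> emeasure (\<mu> x) B = 0"
    by (rule AE_iff_measurable) auto
  then show ?thesis by (simp add: emeasure_scalar_spectral_measure)
qed

lemma AE_E:
  assumes "B \<in> sets borel"
  shows "AE z in \<mu> (E B x). z \<in> B"
proof -
  have "E (- B) (E B x) = E (- B \<inter> B) x"
    using assms by (intro E_Int[symmetric]) auto
  then have "E (- B) (E B x) = 0" by (simp add: E_empty)
  then show ?thesis
    using assms by (simp add: E_eq_0_iff_AE)
qed

lemma sq_bounded:
  assumes "AE z in \<mu> x. cmod (f z) \<le> c"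
  shows "sq x f \<le> ennreal ((c * norm x)\<^sup>2)"
\<comment> \<open>A negative \<open>c\<close> is compatible with the assumption only when the
  measure is zero.\<close>
proof (cases "AE z in \<mu> x. False")
  case True
  then have "sq x f = (\<integral>\<^sup>+z. 0 \<partial>\<mu> x)"
    by (intro nn_integral_cong_AE) auto
  then show ?thesis by simp
next
  case False
  have "c \<ge> 0"
  proof (rule ccontr)
    assume "\<not> 0 \<le> c"
    then have neg: "\<not> cmod (f z) \<le> c" for z
      using norm_ge_zero[of "f z"] by linarith
    from assms have "AE z in \<mu> x. False"
      by (rule AE_mp) (simp add: neg)
    with False show False by simp
  qed
  have "sq x f \<le> sq x (\<lambda>_. complex_of_real c)"
  proof (rule nn_integral_mono_AE)
    show "AE z in \<mu> x. ennreal ((cmod (f z))\<^sup>2) \<le> ennreal ((cmod (complex_of_real c))\<^sup>2)"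
      using assms by (rule AE_mp) (simp add: ennreal_leI power_mono)
  qed
  also have "sq x (\<lambda>_. complex_of_real c) = ennreal ((c * norm x)\<^sup>2)"
    using \<open>c \<ge> 0\<close> sq_const[of x "complex_of_real c"] by simp
  finally show ?thesis .
qed

lemma spectral_integral_norm_le:
  assumes f: "f \<in> borel_measurable borel" and xy: "(x, y) \<in> A f"
    and c: "AE z in \<mu> x. cmod (f z) \<le> c" "0 \<le> c"
  shows "norm y \<le> c * norm x"
proof -
  have "ennreal ((norm y)\<^sup>2) \<le> ennreal ((c * norm x)\<^sup>2)"
    using sq_bounded[OF c(1)] spectral_integral_norm[OF f xy] by simp
  then have "(norm y)\<^sup>2 \<le> (c * norm x)\<^sup>2"
    by (subst (asm) ennreal_le_iff) auto
  then show ?thesis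
    by (rule power2_le_imp_le) (simp add: c(2))
qed

lemma spectral_integral_norm_ge:
  assumes f: "f \<in> borel_measurable borel" and xy: "(x, y) \<in> A f"
    and c: "AE z in \<mu> x. c \<le> cmod (f z)" "0 \<le> c"
  shows "c * norm x \<le> norm y"
proof -
  have "ennreal ((c * norm x)\<^sup>2) = sq x (\<lambda>_. complex_of_real c)"
    using c(2) sq_const[of x "complex_of_real c"] by simp
  also have "\<dots> \<le> sq x f"
  proof (rule nn_integral_mono_AE)
    show "AE z in \<mu> x. ennreal ((cmod (complex_of_real c))\<^sup>2) \<le> ennreal ((cmod (f z))\<^sup>2)"
      using c(1) by (rule AE_mp) (simp add: c(2) ennreal_leI power_mono)
  qed
  also have "\<dots> = ennreal ((norm y)\<^sup>2)"
    by (rule spectral_integral_norm[OF f xy])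
  finally have "(c * norm x)\<^sup>2 \<le> (norm y)\<^sup>2"
    by (subst (asm) ennreal_le_iff) auto
  then show ?thesis
    by (rule power2_le_imp_le) simp
qed

lemma spectral_integral_exists_bounded:
  assumes f: "f \<in> borel_measurable borel" and c: "AE z in \<mu> x. cmod (f z) \<le> c"
  obtains y where "(x, y) \<in> A f"
proof (rule spectral_integral_exists[OF f])
  show "sq x f < \<infinity>"
    using c by (rule le_less_trans[OF sq_bounded]) simp
qed (rule that)

lemma op_apply_spectral_integral:
  assumes f: "f \<in> borel_measurable borel" and xy: "(x, y) \<in> A f"
  shows "op_apply (A f) x = y"
  unfolding op_apply_def using xy spectral_integral_unique[OF f _ xy] by (rule the_equality)

lemma spectral_integral_op_apply:
  assumes f: "f \<in> borel_measurable borel" and c: "\<And>z. cmod (f z) \<le> c"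
  shows "(x, op_apply (A f) x) \<in> A f"
proof -
  have "AE z in \<mu> x. cmod (f z) \<le> c" using c by simp
  then obtain y where y: "(x, y) \<in> A f"
    by (rule spectral_integral_exists_bounded[OF f])
  then show ?thesis using op_apply_spectral_integral[OF f y] by simp
qed

lemma bounded_clinear_op_apply:
  assumes f: "f \<in> borel_measurable borel" and c: "\<And>z. cmod (f z) \<le> c"
  shows "bounded_clinear (op_apply (A f))"
proof -
  have in_A: "(x, op_apply (A f) x) \<in> A f" for x
    by (rule spectral_integral_op_apply[OF f c])
  have scaleC: "op_apply (A f) (a *\<^sub>C x) = a *\<^sub>C op_apply (A f) x" for a x
    by (intro op_apply_spectral_integral[OF f] spectral_integral_scaleC[OF f] in_A)
  have "0 \<le> c" using c[of 0] norm_ge_zero[of "f 0"] by linarith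
  have "bounded_linear (op_apply (A f))"
  proof (rule bounded_linear_intro)
    show "op_apply (A f) (x + y) = op_apply (A f) x + op_apply (A f) y" for x y
      by (intro op_apply_spectral_integral[OF f] spectral_integral_add[OF f] in_A)
    show "op_apply (A f) (r *\<^sub>R x) = r *\<^sub>R op_apply (A f) x" for r x
      using scaleC[of "complex_of_real r" x] by (simp only: scaleC_of_real)
    show "norm (op_apply (A f) x) \<le> norm x * c" for x
      using spectral_integral_norm_le[OF f in_A _ \<open>0 \<le> c\<close>, of x] c by (simp add: mult.commute)
  qed
  then show ?thesis
    using scaleC by (simp add: bounded_clinear_def)
qed

text \<open>The resolvent is \<open>\<integral> 1 / (z - f) dE\<close>, with the integrand set to \<open>0\<close> on the null set.\<close>

lemma in_resolvent_setI:
  assumes f [measurable]: "f \<in> borel_measurable borel" and r: "r > 0"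
    and null: "\<And>x. E (f -` ball z r) x = 0"
  shows "z \<in> resolvent_set (A f)"
proof -
  define B where "B = f -` ball z r"
  have B [measurable]: "B \<in> sets borel"
    using measurable_sets[OF f, of "ball z r"] by (simp add: B_def)
  have AE_B: "AE w in \<mu> x. w \<notin> B" for x
    using null E_eq_0_iff_AE[OF B] by (simp add: B_def)
  have off_B: "r \<le> cmod (z - f w)" if "w \<notin> B" for w
    using that by (simp add: B_def dist_norm)
  define g where "g = (\<lambda>w. if w \<in> B then 0 else 1 / (z - f w))"
  have g [measurable]: "g \<in> borel_measurable borel"
    unfolding g_def by measurable
  have g_le: "cmod (g w) \<le> 1 / r" for w
    using off_B[of w] r by (simp add: g_def norm_divide frac_le)
  \<comment> \<open>Off the null set \<open>B\<close> this says (z - f) g = 1; the right-hand side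
    is visibly bounded, although \<open>f\<close> need not be.\<close>
  have fg: "f w * g w = z * g w - (if w \<in> B then 0 else 1)" for w
  proof (cases "w \<in> B")
    case False
    then have "z - f w \<noteq> 0" using off_B[of w] r by auto
    then show ?thesis using False by (simp add: g_def field_simps)
  qed (simp add: g_def)
  define R where "R = op_apply (A g)"
  have R: "(w, R w) \<in> A g" for w
    unfolding R_def by (rule spectral_integral_op_apply[OF g g_le])
  have resolvent: "(R w, z *\<^sub>C R w - w) \<in> A f" for w
  proof -
    have "cmod (f v * g v) \<le> cmod z * (1 / r) + 1" for v
    proof -
      have "cmod (f v * g v) \<le> cmod (z * g v) + cmod (if v \<in> B then 0 else 1)"
        unfolding fg by (rule norm_triangle_ineq4)
      also have "\<dots> \<le> cmod z * (1 / r) + 1"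
        unfolding norm_mult by (intro add_mono mult_left_mono g_le) auto
      finally show ?thesis .
    qed
    then have "AE v in \<mu> w. cmod (f v * g v) \<le> cmod z * (1 / r) + 1"
      by simp
    then have "sq w (\<lambda>v. f v * g v) < \<infinity>"
      by (rule le_less_trans[OF sq_bounded]) simp
    then obtain y where y: "(R w, y) \<in> A f" "(w, y) \<in> A (\<lambda>v. f v * g v)"
      by (rule spectral_integral_mult[OF g f R])
    \<comment> \<open>The vector \<open>z *\<^sub>C R w - y - w\<close> is the integral at
      \<open>w\<close> of z g - f g - 1, which vanishes off \<open>B\<close>; so its norm is
      0.\<close>
    have "(w, z *\<^sub>C R w - y) \<in> A (\<lambda>v. z * g v - f v * g v)"
      using y(2) R by (intro spectral_integral_diff spectral_integral_cmult) measurable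
    moreover have "(w, w) \<in> A (\<lambda>_. 1)"
      using spectral_integral_const[of w 1] by simp
    ultimately have "ennreal ((norm (z *\<^sub>C R w - y - w))\<^sup>2)
        = sq w (\<lambda>v. (z * g v - f v * g v) - 1)"
      by (intro spectral_integral_dist[symmetric]) measurable
    also have "\<dots> = (\<integral>\<^sup>+v. 0 \<partial>\<mu> w)"
    proof (rule nn_integral_cong_AE)
      show "AE v in \<mu> w. ennreal ((cmod (z * g v - f v * g v - 1))\<^sup>2) = 0"
        using AE_B by (rule AE_mp) (simp add: fg)
    qed
    finally have "y = z *\<^sub>C R w - w"
      by (simp add: algebra_simps)
    then show ?thesis using y(1) by simp
  qed
  \<comment> \<open>The defect \<open>u\<close> is annihilated by z - f, and |z - f| is at least
    \<open>r\<close> almost everywhere, which forces \<open>u = 0\<close>.\<close>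
  have inj: "x = R (z *\<^sub>C x - y)" if xy: "(x, y) \<in> A f" for x y
  proof -
    define u where "u = x - R (z *\<^sub>C x - y)"
    have "(u, z *\<^sub>C u) \<in> A f"
      using spectral_integral_minus_arg[OF f xy resolvent[of "z *\<^sub>C x - y"]]
      by (simp add: u_def scaleC_diff_right algebra_simps)
    then have "(u, z *\<^sub>C u - z *\<^sub>C u) \<in> A (\<lambda>v. z - f v)"
      by (intro spectral_integral_diff spectral_integral_const) auto
    moreover have "AE v in \<mu> u. r \<le> cmod (z - f v)"
      using AE_B by (rule AE_mp) (simp add: off_B)
    ultimately have "r * norm u \<le> norm (z *\<^sub>C u - z *\<^sub>C u)"
      using r by (intro spectral_integral_norm_ge[of "\<lambda>v. z - f v"]) auto
    then have "u = 0" using r by (simp add: mult_le_0_iff)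
    then show ?thesis by (simp add: u_def)
  qed
  have "{(x, z *\<^sub>C x - y) |x y. (x, y) \<in> A f}\<inverse> = {(w, R w) |w. True}"
  proof (intro set_eqI iffI)
    fix p assume "p \<in> {(w, R w) |w. True}"
    then obtain w where "p = (w, R w)" by blast
    then show "p \<in> {(x, z *\<^sub>C x - y) |x y. (x, y) \<in> A f}\<inverse>"
      using resolvent[of w] by force
  qed (use inj in auto)
  moreover have "bounded_clinear R"
    unfolding R_def by (rule bounded_clinear_op_apply[OF g g_le])
  ultimately show ?thesis
    unfolding resolvent_set_def by blast
qed

text \<open>On the range of \<open>E {\<bar>z - f\<bar> < r}\<close> the operator \<open>z - f\<close> has norm at most \<open>r\<close>, which for
  small \<open>r\<close> contradicts the boundedness of its inverse.\<close>

lemma in_resolvent_setD: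
  assumes f [measurable]: "f \<in> borel_measurable borel" and z: "z \<in> resolvent_set (A f)"
  obtains r where "r > 0" "\<And>x. E (f -` ball z r) x = 0"
proof -
  obtain R where R: "bounded_clinear R"
    "{(x, z *\<^sub>C x - y) |x y. (x, y) \<in> A f}\<inverse> = {(w, R w) |w. True}"
    using z unfolding resolvent_set_def by blast
  obtain K where K: "K > 0" "\<And>x. norm (R x) \<le> norm x * K"
    using R(1) bounded_linear.pos_bounded unfolding bounded_clinear_def by blast
  \<comment> \<open>Chosen so that applying z - f and then its inverse yields that
    \<open>norm x\<close> is at most half of itself.\<close>
  define r where "r = 1 / (2 * K)"
  have r: "r > 0" using K by (simp add: r_def)
  define B where "B = f -` ball z r"
  have B: "B \<in> sets borel"
    using measurable_sets[OF f, of "ball z r"] by (simp add: B_def)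
  have "E B v = 0" for v
  proof -
    define x where "x = E B v"
    have AE_B: "AE w in \<mu> x. w \<in> B"
      unfolding x_def by (rule AE_E[OF B])
    have on_B: "cmod (z - f w) \<le> r" if "w \<in> B" for w
      using that by (simp add: B_def dist_norm)
    have "AE w in \<mu> x. cmod (f w) \<le> cmod z + r"
    proof (rule AE_mp[OF AE_B AE_I2], rule impI)
      fix w assume "w \<in> B"
      then show "cmod (f w) \<le> cmod z + r"
        using on_B[of w] norm_triangle_ineq2[of "f w" z] by (simp add: norm_minus_commute)
    qed
    then obtain y where y: "(x, y) \<in> A f"
      by (rule spectral_integral_exists_bounded[OF f])
    have "(x, z *\<^sub>C x - y) \<in> A (\<lambda>w. z - f w)"
      using y by (intro spectral_integral_diff spectral_integral_const) auto
    moreover have "AE w in \<mu> x. cmod (z - f w) \<le> r"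
      using AE_B by (rule AE_mp) (simp add: on_B)
    ultimately have "norm (z *\<^sub>C x - y) \<le> r * norm x"
      using r by (intro spectral_integral_norm_le[of "\<lambda>w. z - f w"]) auto
    moreover have "x = R (z *\<^sub>C x - y)"
    proof -
      have "(z *\<^sub>C x - y, x) \<in> {(w, R w) |w. True}"
        using y unfolding R(2)[symmetric] by blast
      then show ?thesis by blast
    qed
    ultimately have "norm x \<le> (r * norm x) * K"
      using K order_trans[OF K(2)[of "z *\<^sub>C x - y"] mult_right_mono] by (metis less_imp_le)
    then have "x = 0"
      using K by (simp add: r_def)
    then show ?thesis by (simp add: x_def)
  qed
  then show ?thesis
    using that[OF r] by (simp add: B_def)
qed

section \<open>The spectral measure is carried by the spectrum\<close>

abbreviation N :: "'a operator"
  where "N \<equiv> A (\<lambda>z. z)"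

lemma resolvent_set_eq_UN_ball:
  "resolvent_set N = (\<Union>{ball z r |z r. r > 0 \<and> (\<forall>x. E (ball z r) x = 0)})"
proof (intro set_eqI iffI)
  fix z assume "z \<in> resolvent_set N"
  then obtain r where r: "r > 0" "\<And>x. E ((\<lambda>z. z) -` ball z r) x = 0"
    by (rule in_resolvent_setD[rotated]) auto
  show "z \<in> \<Union>{ball z r |z r. r > 0 \<and> (\<forall>x. E (ball z r) x = 0)}"
  proof (rule UnionI)
    show "ball z r \<in> {ball z r |z r. r > 0 \<and> (\<forall>x. E (ball z r) x = 0)}"
      using r unfolding vimage_ident by blast
  qed (simp add: r(1))
next
  fix w assume "w \<in> \<Union>{ball z r |z r. r > 0 \<and> (\<forall>x. E (ball z r) x = 0)}"
  then obtain z r where w: "w \<in> ball z r" and null: "\<And>x. E (ball z r) x = 0"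
    by blast
  have sub: "ball w (r - dist z w) \<subseteq> ball z r"
  proof
    fix v assume "v \<in> ball w (r - dist z w)"
    then show "v \<in> ball z r" using dist_triangle[of z v w] by simp
  qed
  show "w \<in> resolvent_set N"
  proof (rule in_resolvent_setI)
    show "E ((\<lambda>z. z) -` ball w (r - dist z w)) x = 0" for x
      unfolding vimage_ident by (rule E_mono_eq_0[OF _ _ sub null]) simp_all
  qed (use w in simp_all)
qed

lemma open_resolvent_set: "open (resolvent_set N)"
  unfolding resolvent_set_eq_UN_ball by (intro open_Union) auto

lemma spectrum_borel [measurable]: "spectrum N \<in> sets borel"
  unfolding spectrum_def using open_resolvent_set by auto

text \<open>The resolvent set is a possibly uncountable union of null balls; Lindelof reduces it to
  a countable one. Hence the indicator in \<open>exp_op\<close> changes nothing almost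
  everywhere.\<close>

lemma AE_spectrum: "AE z in \<mu> x. z \<in> spectrum N"
proof -
  let ?F = "{ball z r |z r. r > 0 \<and> (\<forall>x. E (ball z r) x = 0)}"
  obtain F' where F': "F' \<subseteq> ?F" "countable F'" "\<Union>F' = \<Union>?F"
    by (rule Lindelof[of ?F]) auto
  have "AE z in \<mu> x. \<forall>B\<in>F'. z \<notin> B"
    unfolding AE_ball_countable[OF F'(2)]
  proof
    fix B assume "B \<in> F'"
    then have "B \<in> sets borel" "E B x = 0" using F'(1) by auto
    then show "AE z in \<mu> x. z \<notin> B" by (simp add: E_eq_0_iff_AE)
  qed
  then show ?thesis
  proof (rule AE_mp[OF _ AE_I2], intro impI)
    fix z assume "\<forall>B\<in>F'. z \<notin> B"
    then have "z \<notin> \<Union>?F" unfolding F'(3)[symmetric] by blast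
    then show "z \<in> spectrum N"
      unfolding spectrum_def resolvent_set_eq_UN_ball by blast
  qed
qed

end

section \<open>Baire category and limits in the extended reals\<close>

lemma dense_INT_open:
  fixes W :: "nat \<Rightarrow> 'a::complete_space set"
  assumes "\<And>n. open (W n)" "\<And>n. closure (W n) = UNIV"
  shows "closure (\<Inter>n. W n) = UNIV"
proof -
  have "Met_TC.mtopology closure_of \<Inter>(range W) = UNIV"
    by (rule Met_TC.metric_Baire_category) (use assms in \<open>auto simp: complete_UNIV\<close>)
  then show ?thesis by simp
qed

text \<open>One natural number serves as time bound and as threshold, so that the condition becomes
  a countable intersection over \<open>n\<close>.\<close>

lemma Limsup_at_top_ereal_eq_PInf_iff:
  fixes f :: "real \<Rightarrow> real"
  shows "Limsup at_top (\<lambda>t. ereal (f t)) = \<infinity> \<longleftrightarrow> (\<forall>n::nat. \<exists>t\<ge>real n. real n < f t)"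
proof (intro iffI allI)
  fix n :: nat
  assume inf: "Limsup at_top (\<lambda>t. ereal (f t)) = \<infinity>"
  show "\<exists>t\<ge>real n. real n < f t"
  proof (rule ccontr)
    assume "\<not> (\<exists>t\<ge>real n. real n < f t)"
    then have "Limsup at_top (\<lambda>t. ereal (f t)) \<le> ereal (real n)"
      by (intro Limsup_bounded eventually_at_top_linorderI[of "real n"]) (simp add: not_less)
    with inf show False by simp
  qed
next
  assume ex: "\<forall>n::nat. \<exists>t\<ge>real n. real n < f t"
  show "Limsup at_top (\<lambda>t. ereal (f t)) = \<infinity>"
  proof (rule ccontr)
    assume "Limsup at_top (\<lambda>t. ereal (f t)) \<noteq> \<infinity>"
    then obtain n :: nat where "Limsup at_top (\<lambda>t. ereal (f t)) < ereal (real n)"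
      using less_PInf_Ex_of_nat by auto
    then have "eventually (\<lambda>t. ereal (f t) < ereal (real n)) at_top"
      by (rule Limsup_lessD)
    then obtain t0 where t0: "\<And>t. t \<ge> t0 \<Longrightarrow> f t < real n"
      by (auto simp: eventually_at_top_linorder)
    obtain m :: nat where m: "max t0 (real n) \<le> real m"
      using real_arch_simple by blast
    obtain t where "t \<ge> real m" "real m < f t" using ex by blast
    then show False using t0[of t] m by simp
  qed
qed

lemma Liminf_at_top_ereal_eq_0_iff:
  fixes f :: "real \<Rightarrow> real"
  assumes nonneg: "\<And>t. t \<ge> 0 \<Longrightarrow> f t \<ge> 0"
  shows "Liminf at_top (\<lambda>t. ereal (f t)) = 0
    \<longleftrightarrow> (\<forall>n::nat. \<exists>t\<ge>real n. f t < 1 / real (Suc n))"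
proof (intro iffI allI)
  fix n :: nat
  assume zero: "Liminf at_top (\<lambda>t. ereal (f t)) = 0"
  show "\<exists>t\<ge>real n. f t < 1 / real (Suc n)"
  proof (rule ccontr)
    assume "\<not> (\<exists>t\<ge>real n. f t < 1 / real (Suc n))"
    then have "ereal (1 / real (Suc n)) \<le> Liminf at_top (\<lambda>t. ereal (f t))"
      by (intro Liminf_bounded eventually_at_top_linorderI[of "real n"]) (simp add: not_less)
    with zero have "ereal (1 / real (Suc n)) \<le> ereal 0" by (simp add: zero_ereal_def)
    then show False by (subst (asm) ereal_less_eq(3)) (simp add: field_simps)
  qed
next
  assume ex: "\<forall>n::nat. \<exists>t\<ge>real n. f t < 1 / real (Suc n)"
  have ge: "0 \<le> Liminf at_top (\<lambda>t. ereal (f t))"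
    using nonneg by (intro Liminf_bounded eventually_at_top_linorderI[of 0]) simp
  have "\<not> 0 < Liminf at_top (\<lambda>t. ereal (f t))"
  proof
    assume "0 < Liminf at_top (\<lambda>t. ereal (f t))"
    then obtain y where y: "0 < ereal y" "ereal y < Liminf at_top (\<lambda>t. ereal (f t))"
      using ereal_dense2 by blast
    from y(2) have "eventually (\<lambda>t. ereal y < ereal (f t)) at_top"
      by (rule less_LiminfD)
    then obtain t0 where t0: "\<And>t. t \<ge> t0 \<Longrightarrow> y < f t"
      by (auto simp: eventually_at_top_linorder)
    obtain m :: nat where m: "max t0 (1 / y) \<le> real m"
      using real_arch_simple by blast
    obtain t where t: "t \<ge> real m" "f t < 1 / real (Suc m)" using ex by blast
    have "1 / y \<le> real (Suc m)" using m by simp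
    then have "1 / real (Suc m) \<le> y" using y(1) by (simp add: field_simps)
    then show False using t0[of t] t m by simp
  qed
  with ge show "Liminf at_top (\<lambda>t. ereal (f t)) = 0" by simp
qed

section \<open>The semigroup of a normal operator with spectrum in the left half-plane\<close>

lemma half_plane_borel [measurable]: "{z. c < Re z} \<in> sets borel" "{z. c \<le> Re z} \<in> sets borel"
  by (auto intro!: borel_open borel_closed open_halfspace_Re_gt closed_halfspace_Re_ge)

lemma of_real_Re_borel [measurable]:
  "(\<lambda>z. complex_of_real (Re z)) \<in> borel_measurable borel"
  by (intro borel_measurable_continuous_onI continuous_intros)

locale dissipative_resolution = spectral_resolution +
  assumes right_half_plane: "{z. Re z > 0} \<subseteq> resolvent_set (spectral_integral E (\<lambda>z. z))"
begin

abbreviation T :: "real \<Rightarrow> 'a \<Rightarrow> 'a"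
  where "T \<equiv> exp_op N E"

lemma Re_spectrum: "z \<in> spectrum N \<Longrightarrow> Re z \<le> 0"
  using right_half_plane unfolding spectrum_def by (meson ComplD linorder_not_le mem_Collect_eq subsetD)

lemma AE_Re_le_0: "AE z in \<mu> x. Re z \<le> 0"
  using AE_spectrum by (rule AE_mp) (simp add: Re_spectrum)

definition exp_symbol :: "real \<Rightarrow> complex \<Rightarrow> complex"
  where "exp_symbol t z = indicator (spectrum N) z * exp (complex_of_real t * z)"

lemma exp_symbol_borel [measurable]: "exp_symbol t \<in> borel_measurable borel"
proof -
  have [measurable]: "(\<lambda>z. exp (complex_of_real t * z)) \<in> borel_measurable borel"
    by (intro borel_measurable_continuous_onI continuous_intros)
  show ?thesis unfolding exp_symbol_def[abs_def] by measurable
qed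

lemma cmod_exp_symbol: "z \<in> spectrum N \<Longrightarrow> cmod (exp_symbol t z) = exp (t * Re z)"
  by (simp add: exp_symbol_def norm_mult)

text \<open>Thanks to the cutoff by the spectrum the bound holds at every point, so that
  \<open>T t\<close> is everywhere defined.\<close>

lemma cmod_exp_symbol_le_1: "t \<ge> 0 \<Longrightarrow> cmod (exp_symbol t z) \<le> 1"
  using Re_spectrum[of z]
  by (cases "z \<in> spectrum N") (auto simp: cmod_exp_symbol mult_nonneg_nonpos, simp add: exp_symbol_def)

lemma T_eq: "T t = op_apply (A (exp_symbol t))"
  unfolding exp_op_def exp_symbol_def[abs_def] ..

lemma T_in: "t \<ge> 0 \<Longrightarrow> (x, T t x) \<in> A (exp_symbol t)"
  unfolding T_eq by (rule spectral_integral_op_apply[OF exp_symbol_borel cmod_exp_symbol_le_1])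

lemma bounded_linear_T: "t \<ge> 0 \<Longrightarrow> bounded_linear (T t)"
  using bounded_clinear_op_apply[OF exp_symbol_borel cmod_exp_symbol_le_1] unfolding T_eq bounded_clinear_def by blast

lemma T_diff: "t \<ge> 0 \<Longrightarrow> T t (x - y) = T t x - T t y"
  by (rule linear_diff[OF bounded_linear.linear[OF bounded_linear_T]])

lemma T_add: "t \<ge> 0 \<Longrightarrow> T t (x + y) = T t x + T t y"
  by (rule linear_add[OF bounded_linear.linear[OF bounded_linear_T]])

lemma T_scaleR: "t \<ge> 0 \<Longrightarrow> T t (c *\<^sub>R x) = c *\<^sub>R T t x"
  by (rule linear_cmul[OF bounded_linear.linear[OF bounded_linear_T]])

lemma norm_T_le:
  assumes t: "t \<ge> 0" and r: "AE z in \<mu> x. Re z \<le> - r"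
  shows "norm (T t x) \<le> exp (- r * t) * norm x"
proof (rule spectral_integral_norm_le[OF exp_symbol_borel T_in[OF t]])
  show "AE z in \<mu> x. cmod (exp_symbol t z) \<le> exp (- r * t)"
    using r AE_spectrum
  proof eventually_elim
    case (elim z)
    then show ?case
      using mult_left_mono[OF elim(1) t] by (simp add: cmod_exp_symbol mult.commute)
  qed
qed simp

lemma norm_T_ge:
  assumes t: "t \<ge> 0" and r: "AE z in \<mu> x. - r \<le> Re z"
  shows "exp (- r * t) * norm x \<le> norm (T t x)"
proof (rule spectral_integral_norm_ge[OF exp_symbol_borel T_in[OF t]])
  show "AE z in \<mu> x. exp (- r * t) \<le> cmod (exp_symbol t z)"
    using r AE_spectrum
  proof eventually_elim
    case (elim z)
    then show ?case
      using mult_left_mono[OF elim(1) t] by (simp add: cmod_exp_symbol mult.commute)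
  qed
qed simp

lemma norm_T_contraction: "t \<ge> 0 \<Longrightarrow> norm (T t x) \<le> norm x"
  using norm_T_le[of t 0 x] AE_Re_le_0 by simp

text \<open>Real parts on the spectrum are nonpositive, so the modulus of the integrand decreases in
  time.\<close>

lemma norm_T_antimono:
  assumes "0 \<le> s" "s \<le> t"
  shows "norm (T t x) \<le> norm (T s x)"
proof -
  have t: "0 \<le> t" using assms by simp
  have "sq x (exp_symbol t) \<le> sq x (exp_symbol s)"
  proof (rule nn_integral_mono_AE)
    show "AE z in \<mu> x. ennreal ((cmod (exp_symbol t z))\<^sup>2) \<le> ennreal ((cmod (exp_symbol s z))\<^sup>2)"
      using AE_spectrum
    proof eventually_elim
      case (elim z)
      then have "t * Re z \<le> s * Re z"
        using Re_spectrum assms(2) by (intro mult_right_mono_neg)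
      then show ?case
        using elim by (intro ennreal_leI power_mono) (auto simp: cmod_exp_symbol)
    qed
  qed
  then have "ennreal ((norm (T t x))\<^sup>2) \<le> ennreal ((norm (T s x))\<^sup>2)"
    using spectral_integral_norm[OF exp_symbol_borel T_in[OF t]]
      spectral_integral_norm[OF exp_symbol_borel T_in[OF assms(1)]] by simp
  then have "(norm (T t x))\<^sup>2 \<le> (norm (T s x))\<^sup>2"
    by (subst (asm) ennreal_le_iff) auto
  then show ?thesis
    by (rule power2_le_imp_le) simp
qed

text \<open>The preimage of a ball around 0 under the real part is a two-sided strip; its right half
  and everything beyond it are already null.\<close>

lemma zero_in_resolvent_real_part_iff:
  "0 \<in> resolvent_set (real_part_op E) \<longleftrightarrow> (\<exists>r>0. \<forall>x. E {z. - r < Re z} x = 0)"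
proof -
  have vimage: "(\<lambda>z. complex_of_real (Re z)) -` ball 0 r = {z. \<bar>Re z\<bar> < r}" for r
    by auto
  have strip: "{z::complex. \<bar>Re z\<bar> < r} \<in> sets borel" for r
    using measurable_sets[OF of_real_Re_borel, of "ball 0 r"] unfolding vimage by simp
  show ?thesis
  proof
    assume "0 \<in> resolvent_set (real_part_op E)"
    then have "0 \<in> resolvent_set (A (\<lambda>z. complex_of_real (Re z)))"
      unfolding real_part_op_def .
    then obtain r where r: "r > 0" "\<And>x. E ((\<lambda>z. complex_of_real (Re z)) -` ball 0 r) x = 0"
      by (rule in_resolvent_setD[OF of_real_Re_borel]) (rule that)
    have "AE z in \<mu> x. z \<notin> {z. - r < Re z}" for x
    proof -
      have "AE z in \<mu> x. z \<notin> {z. \<bar>Re z\<bar> < r}"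
        using r(2)[of x] unfolding vimage E_eq_0_iff_AE[OF strip] .
      with AE_Re_le_0[of x] show ?thesis
        by eventually_elim (use r(1) in simp)
    qed
    then show "\<exists>r>0. \<forall>x. E {z. - r < Re z} x = 0"
      using r(1) unfolding E_eq_0_iff_AE[OF half_plane_borel(1)] by blast
  next
    assume "\<exists>r>0. \<forall>x. E {z. - r < Re z} x = 0"
    then obtain r where r: "r > 0" "\<And>x. E {z. - r < Re z} x = 0" by blast
    have sub: "{z. \<bar>Re z\<bar> < r} \<subseteq> {z. - r < Re z}" by auto
    show "0 \<in> resolvent_set (real_part_op E)"
      unfolding real_part_op_def
    proof (rule in_resolvent_setI[OF of_real_Re_borel r(1)])
      show "E ((\<lambda>z. complex_of_real (Re z)) -` ball 0 r) x = 0" for x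
        unfolding vimage by (rule E_mono_eq_0[OF strip half_plane_borel(1) sub r(2)])
    qed
  qed
qed

lemma eigenvalue_real_part_iff:
  "eigenvalue (real_part_op E) 0 \<longleftrightarrow> (\<exists>x. x \<noteq> 0 \<and> (AE z in \<mu> x. Re z = 0))"
proof -
  let ?f = "\<lambda>z. complex_of_real (Re z)"
  note f = of_real_Re_borel
  have "(x, 0) \<in> A ?f \<longleftrightarrow> (AE z in \<mu> x. Re z = 0)" for x
  proof
    assume "(x, 0) \<in> A ?f"
    then have "sq x ?f = 0" using spectral_integral_norm[OF f, of x 0] by simp
    moreover have "sq x ?f = 0 \<longleftrightarrow> (AE z in \<mu> x. ennreal ((cmod (?f z))\<^sup>2) = 0)"
      by (rule nn_integral_0_iff_AE) measurable
    ultimately show "AE z in \<mu> x. Re z = 0" by simp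
  next
    assume AE: "AE z in \<mu> x. Re z = 0"
    then have le: "AE z in \<mu> x. cmod (?f z) \<le> 0" by simp
    then obtain y where y: "(x, y) \<in> A ?f"
      by (rule spectral_integral_exists_bounded[OF f])
    have "norm y \<le> 0 * norm x"
      by (rule spectral_integral_norm_le[OF f y le]) simp
    then show "(x, 0) \<in> A ?f" using y by simp
  qed
  then show ?thesis
    unfolding eigenvalue_def real_part_op_def by simp
qed

section \<open>The trichotomy\<close>

lemma exponentially_decaying_orbits_of_spectral_gap:
  assumes "0 \<notin> spectrum (real_part_op E)"
  shows "exponentially_decaying_orbits N E"
proof -
  obtain r where r: "r > 0" "\<And>x. E {z. - r < Re z} x = 0"
    using assms zero_in_resolvent_real_part_iff unfolding spectrum_def by blast
  \<comment> \<open>The summand 1 keeps the constant positive when \<open>x = 0\<close>.\<close>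
  have "norm (T t x) \<le> (norm x + 1) * exp (- r * t)" if "t \<ge> 0" for t x
  proof -
    have "AE z in \<mu> x. z \<notin> {z. - r < Re z}"
      using r(2)[of x] unfolding E_eq_0_iff_AE[OF half_plane_borel(1)] .
    then have "AE z in \<mu> x. Re z \<le> - r"
      by eventually_elim simp
    then have "norm (T t x) \<le> exp (- r * t) * norm x"
      by (rule norm_T_le[OF that])
    also have "\<dots> \<le> (norm x + 1) * exp (- r * t)"
      by (simp add: algebra_simps)
    finally show ?thesis .
  qed
  moreover have "norm x + 1 > 0" for x :: 'a
    using norm_ge_zero[of x] by linarith
  ultimately show ?thesis
    unfolding exponentially_decaying_orbits_def using r(1) by blast
qed

section \<open>Orbits that do not tend to zero\<close>

lemma T_tendsto_0_iff:
  "((\<lambda>t. T t x) \<longlongrightarrow> 0) at_top \<longleftrightarrow> (\<forall>\<epsilon>>0. \<exists>t\<ge>0. norm (T t x) < \<epsilon>)"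
proof (intro iffI allI impI)
  fix \<epsilon> :: real assume "((\<lambda>t. T t x) \<longlongrightarrow> 0) at_top" and "\<epsilon> > 0"
  then have "eventually (\<lambda>t. dist (T t x) 0 < \<epsilon>) at_top"
    by (rule tendstoD)
  then have "eventually (\<lambda>t. 0 \<le> t \<and> norm (T t x) < \<epsilon>) at_top"
    using eventually_ge_at_top[of 0] by eventually_elim simp
  then show "\<exists>t\<ge>0. norm (T t x) < \<epsilon>"
    using eventually_happens trivial_limit_at_top_linorder by blast
next
  assume small: "\<forall>\<epsilon>>0. \<exists>t\<ge>0. norm (T t x) < \<epsilon>"
  show "((\<lambda>t. T t x) \<longlongrightarrow> 0) at_top"
  proof (rule tendstoI)
    fix \<epsilon> :: real assume "\<epsilon> > 0"
    then obtain s where s: "s \<ge> 0" "norm (T s x) < \<epsilon>" using small by blast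
    have "dist (T t x) 0 < \<epsilon>" if "t \<ge> s" for t
      using norm_T_antimono[OF s(1) that, of x] s(2) by simp
    then show "eventually (\<lambda>t. dist (T t x) 0 < \<epsilon>) at_top"
      by (rule eventually_at_top_linorderI)
  qed
qed

lemma F_set_iff: "x \<in> F_set N E \<longleftrightarrow> (\<exists>\<epsilon>>0. \<forall>t\<ge>0. \<epsilon> \<le> norm (T t x))"
  unfolding F_set_def mem_Collect_eq T_tendsto_0_iff by (meson not_less)

lemma open_F_set: "open (F_set N E)"
  unfolding open_contains_ball
proof
  fix x assume "x \<in> F_set N E"
  then obtain \<epsilon> where \<epsilon>: "\<epsilon> > 0" "\<And>t. t \<ge> 0 \<Longrightarrow> \<epsilon> \<le> norm (T t x)"
    unfolding F_set_iff by blast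
  have "ball x (\<epsilon> / 2) \<subseteq> F_set N E"
  proof
    fix y assume "y \<in> ball x (\<epsilon> / 2)"
    then have y: "norm (x - y) < \<epsilon> / 2" by (simp add: dist_norm)
    have "\<epsilon> / 2 \<le> norm (T t y)" if t: "t \<ge> 0" for t
      using \<epsilon>(2)[OF t] norm_triangle_ineq2[of "T t x" "T t y"] norm_T_contraction[OF t, of "x - y"] y
      unfolding T_diff[OF t] by linarith
    then show "y \<in> F_set N E"
      unfolding F_set_iff using \<epsilon>(1) by (intro exI[of _ "\<epsilon> / 2"]) simp
  qed
  then show "\<exists>e>0. ball x e \<subseteq> F_set N E"
    using \<epsilon>(1) half_gt_zero by blast
qed

lemma closure_F_set:
  assumes "eigenvalue (real_part_op E) 0"
  shows "closure (F_set N E) = UNIV"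
proof -
  obtain u where u: "u \<noteq> 0" "AE z in \<mu> u. Re z = 0"
    using assms unfolding eigenvalue_real_part_iff by blast
  have norm_T_u: "norm u \<le> norm (T t u)" if "t \<ge> 0" for t
  proof -
    have "AE z in \<mu> u. - 0 \<le> Re z"
      using u(2) by eventually_elim simp
    then show ?thesis using norm_T_ge[OF that, of 0 u] by simp
  qed
  have "x \<in> closure (F_set N E)" for x
  proof (cases "x \<in> F_set N E")
    case True
    then show ?thesis using closure_subset by blast
  next
    case False
    then have lim: "((\<lambda>t. T t x) \<longlongrightarrow> 0) at_top" by (simp add: F_set_def)
    \<comment> \<open>Otherwise the difference of two decaying orbits, that of
      \<open>c *\<^sub>R u\<close>, would decay, although its norm never drops below that of
      \<open>c *\<^sub>R u\<close>.\<close>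
    have perturb: "x + c *\<^sub>R u \<in> F_set N E" if c: "c > 0" for c
    proof (rule ccontr)
      assume "x + c *\<^sub>R u \<notin> F_set N E"
      then have "((\<lambda>t. T t (x + c *\<^sub>R u)) \<longlongrightarrow> 0) at_top" by (simp add: F_set_def)
      then have "((\<lambda>t. T t (x + c *\<^sub>R u) - T t x) \<longlongrightarrow> 0 - 0) at_top"
        using lim by (rule tendsto_diff)
      moreover have "eventually (\<lambda>t. T t (x + c *\<^sub>R u) - T t x = c *\<^sub>R T t u) at_top"
        using eventually_ge_at_top[of 0] by eventually_elim (simp add: T_add T_scaleR)
      ultimately have "((\<lambda>t. c *\<^sub>R T t u) \<longlongrightarrow> 0) at_top"
        by (simp add: tendsto_cong)
      then have "((\<lambda>t. T t u) \<longlongrightarrow> 0) at_top"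
        using tendsto_scaleR[OF tendsto_const[of "1 / c"]] c by fastforce
      then obtain t where "t \<ge> 0" "norm (T t u) < norm u"
        using u(1) unfolding T_tendsto_0_iff by (meson zero_less_norm_iff)
      then show False using norm_T_u[of t] by simp
    qed
    show ?thesis
      unfolding closure_approachable
    proof (intro allI impI)
      fix \<epsilon> :: real assume \<epsilon>: "\<epsilon> > 0"
      define c where "c = \<epsilon> / (2 * norm u)"
      have "c > 0" using \<epsilon> u(1) by (simp add: c_def)
      moreover have "dist (x + c *\<^sub>R u) x < \<epsilon>"
        using \<epsilon> u(1) by (simp add: dist_norm c_def)
      ultimately show "\<exists>y\<in>F_set N E. dist y x < \<epsilon>" using perturb by blast
    qed
  qed
  then show ?thesis by blast
qed

section \<open>Fast growth and fast decay along subsequences of times\<close>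

lemma open_T_vimage: "t \<ge> 0 \<Longrightarrow> open W \<Longrightarrow> open {x. a * norm (T t x) \<in> W}"
proof -
  assume t: "t \<ge> 0" and W: "open W"
  have "continuous_on UNIV (\<lambda>x. a * norm (T t x))"
    using bounded_linear.continuous_on[OF bounded_linear_T[OF t] continuous_on_id]
    by (intro continuous_intros)
  then show ?thesis
    using open_vimage[OF W] by (simp add: vimage_def)
qed

definition growth_set :: "(real \<Rightarrow> real) \<Rightarrow> nat \<Rightarrow> 'a set"
  where "growth_set \<alpha> n = {x. \<exists>t\<ge>real n. real n < \<alpha> t * norm (T t x)}"

definition decay_set :: "(real \<Rightarrow> real) \<Rightarrow> nat \<Rightarrow> 'a set"
  where "decay_set \<beta> n = {x. \<exists>t\<ge>real n. \<beta> t * norm (T t x) < 1 / real (Suc n)}"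

lemma open_growth_set: "open (growth_set \<alpha> n)"
proof -
  have "growth_set \<alpha> n = (\<Union>t\<in>{real n..}. {x. \<alpha> t * norm (T t x) \<in> {real n<..}})"
    by (auto simp: growth_set_def)
  also have "open \<dots>"
    by (intro open_UN ballI open_T_vimage) auto
  finally show ?thesis .
qed

lemma open_decay_set: "open (decay_set \<beta> n)"
proof -
  have "decay_set \<beta> n = (\<Union>t\<in>{real n..}. {x. \<beta> t * norm (T t x) \<in> {..<1 / real (Suc n)}})"
    by (auto simp: decay_set_def)
  also have "open \<dots>"
    by (intro open_UN ballI open_T_vimage) auto
  finally show ?thesis .
qed

lemma G_set_eq:
  assumes "\<And>t. t \<ge> 0 \<Longrightarrow> \<beta> t > 0"
  shows "G_set N E \<alpha> \<beta> = (\<Inter>n. growth_set \<alpha> n \<inter> decay_set \<beta> n)"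
proof -
  have "\<beta> t * norm (T t x) \<ge> 0" if "t \<ge> 0" for t x
    using assms[OF that] by simp
  then show ?thesis
    unfolding G_set_def growth_set_def decay_set_def
    by (subst Liminf_at_top_ereal_eq_0_iff) (auto simp: Limsup_at_top_ereal_eq_PInf_iff)
qed

text \<open>Uniform boundedness: vectors supported in a thin strip show that \<^term>\<open>T t\<close> has norm \<open>1\<close>, so
  \<^term>\<open>\<alpha> t * norm (T t x)\<close> cannot stay bounded for all \<open>x\<close> in a ball.\<close>

lemma closure_growth_set:
  assumes spec: "0 \<in> spectrum (real_part_op E)" and \<alpha>: "filterlim \<alpha> at_top at_top"
  shows "closure (growth_set \<alpha> n) = UNIV"
proof (rule ccontr)
  assume "closure (growth_set \<alpha> n) \<noteq> UNIV"
  then obtain x where "x \<notin> closure (growth_set \<alpha> n)" by blast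
  then obtain \<delta> where \<delta>: "\<delta> > 0" and far: "\<And>y. dist y x < \<delta> \<Longrightarrow> y \<notin> growth_set \<alpha> n"
    unfolding closure_approachable by blast
  \<comment> \<open>The final estimate reads \<alpha>(t) \<delta> / 4 \<le> 2n; the added 1 makes
    the contradiction strict and \<alpha>(t) positive.\<close>
  have "eventually (\<lambda>t. 8 * real n / \<delta> + 1 \<le> \<alpha> t) at_top"
    using \<alpha> unfolding filterlim_at_top by blast
  then have "eventually (\<lambda>t. real n \<le> t \<and> 8 * real n / \<delta> + 1 \<le> \<alpha> t) at_top"
    using eventually_ge_at_top[of "real n"] by eventually_elim simp
  then obtain t where t: "real n \<le> t" "8 * real n / \<delta> + 1 \<le> \<alpha> t"
    using eventually_happens trivial_limit_at_top_linorder by blast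
  have t0: "t \<ge> 0" using t(1) by linarith
  have \<alpha>t: "\<alpha> t > 8 * real n / \<delta>" "\<alpha> t > 0"
  proof -
    show "\<alpha> t > 8 * real n / \<delta>" using t(2) by simp
    moreover have "8 * real n / \<delta> \<ge> 0" using \<delta> by simp
    ultimately show "\<alpha> t > 0" by linarith
  qed
  \<comment> \<open>The strip is adapted to the time \<open>t\<close>: r t \<le> 1/2, so exp(-r t)
    \<ge> 1 - r t \<ge> 1/2.\<close>
  define r where "r = 1 / (2 * (t + 1))"
  have r: "r > 0" "1 / 2 \<le> exp (- r * t)"
  proof -
    show "r > 0" using t0 by (simp add: r_def)
    have "r * t \<le> 1 / 2" using t0 by (simp add: r_def field_simps)
    then show "1 / 2 \<le> exp (- r * t)"
      using exp_ge_add_one_self[of "- r * t"] by simp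
  qed
  obtain v where v: "E {z. - r < Re z} v \<noteq> 0"
    using spec zero_in_resolvent_real_part_iff r(1) unfolding spectrum_def by blast
  define u where "u = E {z. - r < Re z} v"
  have "AE z in \<mu> u. z \<in> {z. - r < Re z}"
    unfolding u_def by (rule AE_E[OF half_plane_borel(1)])
  then have "AE z in \<mu> u. - r \<le> Re z"
    by eventually_elim simp
  then have "exp (- r * t) * norm u \<le> norm (T t u)"
    by (rule norm_T_ge[OF t0])
  moreover have "1 / 2 * norm u \<le> exp (- r * t) * norm u"
    using r(2) by (intro mult_right_mono) auto
  ultimately have T_u: "norm u / 2 \<le> norm (T t u)" by simp
  define c where "c = \<delta> / (2 * norm u)"
  have c: "c > 0" "norm (c *\<^sub>R u) = \<delta> / 2"
    using v \<delta> by (simp_all add: c_def u_def)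
  have "\<alpha> t * norm (T t x) \<le> real n"
    using far[of x] \<delta> t(1) unfolding growth_set_def by (simp add: not_less)
  moreover have "\<alpha> t * norm (T t (x + c *\<^sub>R u)) \<le> real n"
  proof -
    have "dist (x + c *\<^sub>R u) x < \<delta>" using c \<delta> by (simp add: dist_norm)
    from far[OF this] show ?thesis using t(1) unfolding growth_set_def by (simp add: not_less)
  qed
  moreover have "\<alpha> t * norm (T t (c *\<^sub>R u))
      \<le> \<alpha> t * norm (T t (x + c *\<^sub>R u)) + \<alpha> t * norm (T t x)"
  proof -
    have "norm (T t (c *\<^sub>R u)) \<le> norm (T t (x + c *\<^sub>R u)) + norm (T t x)"
      using norm_triangle_ineq4[of "T t (x + c *\<^sub>R u)" "T t x"] by (simp add: T_add[OF t0])
    then show ?thesis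
      using \<alpha>t(2) by (simp add: mult_left_mono flip: distrib_left)
  qed
  moreover have "\<alpha> t * (\<delta> / 4) \<le> \<alpha> t * norm (T t (c *\<^sub>R u))"
  proof (rule mult_left_mono)
    have "c * (norm u / 2) \<le> c * norm (T t u)"
      using T_u c(1) by (intro mult_left_mono) auto
    moreover have "c * norm u = \<delta> / 2" using c by simp
    ultimately show "\<delta> / 4 \<le> norm (T t (c *\<^sub>R u))"
      using c(1) by (simp add: T_scaleR[OF t0])
  qed (use \<alpha>t in simp)
  ultimately have "\<alpha> t * (\<delta> / 4) \<le> 2 * real n" by linarith
  then have "\<alpha> t \<le> 8 * real n / \<delta>" using \<delta> by (simp add: field_simps)
  then show False using \<alpha>t(1) by simp
qed

text \<open>Removing from \<open>x\<close> its component in a thin strip leaves an exponentially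
  decaying vector, and exponential decay beats \<beta>. The removed part is small because the strips
  shrink to the closed right half-plane, which is null without an eigenvector.\<close>

lemma closure_decay_set:
  assumes no_eig: "\<not> eigenvalue (real_part_op E) 0"
    and \<beta>: "\<And>t. t \<ge> 0 \<Longrightarrow> \<beta> t > 0"
      "\<And>\<epsilon>. \<epsilon> > 0 \<Longrightarrow> ((\<lambda>t. \<beta> t * exp (- t * \<epsilon>)) \<longlongrightarrow> 0) at_top"
  shows "closure (decay_set \<beta> n) = UNIV"
proof -
  have "x \<in> closure (decay_set \<beta> n)" for x
    unfolding closure_approachable
  proof (intro allI impI)
    fix \<epsilon> :: real assume \<epsilon>: "\<epsilon> > 0"
    define B where "B k = {z. - (1 / real (Suc k)) < Re z}" for k
    have B: "B k \<in> sets borel" for k unfolding B_def by (rule half_plane_borel)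
    have "(\<lambda>k. emeasure (\<mu> x) (B k)) \<longlonglongrightarrow> emeasure (\<mu> x) (\<Inter>k. B k)"
    proof (rule Lim_emeasure_decseq)
      show "decseq B"
      proof (rule decseq_SucI)
        fix k
        have "1 / real (Suc (Suc k)) \<le> 1 / real (Suc k)" by (simp add: frac_le)
        then show "B (Suc k) \<subseteq> B k" unfolding B_def by auto
      qed
      show "emeasure (\<mu> x) (B k) \<noteq> \<infinity>" for k
        by (simp add: emeasure_scalar_spectral_measure B)
    qed (use B in auto)
    also have "(\<Inter>k. B k) = {z. 0 \<le> Re z}"
    proof (intro set_eqI iffI)
      fix z assume z: "z \<in> (\<Inter>k. B k)"
      show "z \<in> {z. 0 \<le> Re z}"
      proof (rule ccontr)
        assume "z \<notin> {z. 0 \<le> Re z}"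
        then obtain k where "inverse (real (Suc k)) < - Re z"
          using reals_Archimedean[of "- Re z"] by auto
        moreover have "z \<in> B k" using z by blast
        ultimately show False by (simp add: B_def inverse_eq_divide)
      qed
    next
      fix z :: complex assume "z \<in> {z. 0 \<le> Re z}"
      then have "- (1 / real (Suc k)) < Re z" for k
        by (simp add: less_le_trans[of _ 0])
      then show "z \<in> (\<Inter>k. B k)" by (simp add: B_def)
    qed
    finally have lim: "(\<lambda>k. emeasure (\<mu> x) (B k)) \<longlonglongrightarrow> emeasure (\<mu> x) {z. 0 \<le> Re z}" .
    have "E {z. 0 \<le> Re z} x = 0"
    proof (rule ccontr)
      assume "E {z. 0 \<le> Re z} x \<noteq> 0"
      moreover have "AE z in \<mu> (E {z. 0 \<le> Re z} x). Re z = 0"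
        using AE_E[OF half_plane_borel(2)[of 0], of x] AE_Re_le_0
        by eventually_elim simp
      ultimately show False
        using no_eig unfolding eigenvalue_real_part_iff by blast
    qed
    then have "emeasure (\<mu> x) {z. 0 \<le> Re z} = 0"
      by (simp add: emeasure_scalar_spectral_measure half_plane_borel)
    with lim have "(\<lambda>k. ennreal ((norm (E (B k) x))\<^sup>2)) \<longlonglongrightarrow> 0"
      by (simp add: emeasure_scalar_spectral_measure B)
    then have "(\<lambda>k. norm (E (B k) x)) \<longlonglongrightarrow> 0"
      by (simp add: ennreal_tendsto_0_iff)
    then have "eventually (\<lambda>k. norm (E (B k) x) < \<epsilon>) sequentially"
      using \<epsilon> by (rule order_tendstoD)
    then obtain k where k: "norm (E (B k) x) < \<epsilon>"
      using eventually_happens trivial_limit_sequentially by blast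
    define r where "r = 1 / real (Suc k)"
    define y where "y = E (- B k) x"
    have "x = y + E (B k) x"
      using E_Un[of "- B k" "B k" x] B[of k] by (simp add: y_def E_UNIV)
    then have "dist y x = norm (E (B k) x)"
      by (metis add_diff_cancel_left' dist_commute dist_norm)
    then have "dist y x < \<epsilon>" using k by simp
    moreover have "y \<in> decay_set \<beta> n"
    proof -
      have "AE z in \<mu> y. z \<in> - B k"
        unfolding y_def using B[of k] by (intro AE_E) auto
      then have AE_y: "AE z in \<mu> y. Re z \<le> - r"
        by eventually_elim (simp add: B_def r_def)
      have "((\<lambda>t. \<beta> t * exp (- t * r) * norm y) \<longlongrightarrow> 0 * norm y) at_top"
        by (intro tendsto_mult \<beta>(2) tendsto_const) (simp add: r_def)
      then have "eventually (\<lambda>t. \<beta> t * exp (- t * r) * norm y < 1 / real (Suc n)) at_top"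
        by (rule order_tendstoD(2)) simp
      then have "eventually (\<lambda>t. real n \<le> t \<and> \<beta> t * exp (- t * r) * norm y < 1 / real (Suc n)) at_top"
        using eventually_ge_at_top[of "real n"] by eventually_elim simp
      then obtain t where t: "real n \<le> t" "\<beta> t * exp (- t * r) * norm y < 1 / real (Suc n)"
        using eventually_happens trivial_limit_at_top_linorder by blast
      have t0: "t \<ge> 0" using t(1) by linarith
      have "\<beta> t * norm (T t y) \<le> \<beta> t * (exp (- r * t) * norm y)"
        using norm_T_le[OF t0 AE_y] \<beta>(1)[OF t0] by (intro mult_left_mono) auto
      also have "\<dots> < 1 / real (Suc n)"
        using t(2) by (simp add: mult.commute mult.left_commute)
      finally show ?thesis unfolding decay_set_def using t(1) by blast
    qed
    ultimately show "\<exists>y\<in>decay_set \<beta> n. dist y x < \<epsilon>" by blast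
  qed
  then show ?thesis by blast
qed

lemma G_set_residual:
  assumes "0 \<in> spectrum (real_part_op E)" "\<not> eigenvalue (real_part_op E) 0"
    and "admissible_pair \<alpha> \<beta>"
  shows "closure (G_set N E \<alpha> \<beta>) = UNIV" "gdelta (G_set N E \<alpha> \<beta>)"
proof -
  have adm: "\<And>t. t \<ge> 0 \<Longrightarrow> \<beta> t > 0" "filterlim \<alpha> at_top at_top"
    "\<And>\<epsilon>. \<epsilon> > 0 \<Longrightarrow> ((\<lambda>t. \<beta> t * exp (- t * \<epsilon>)) \<longlongrightarrow> 0) at_top"
    using assms(3) unfolding admissible_pair_def by blast+
  have W: "open (growth_set \<alpha> n \<inter> decay_set \<beta> n)" "closure (growth_set \<alpha> n \<inter> decay_set \<beta> n) = UNIV" for n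
  proof -
    show "open (growth_set \<alpha> n \<inter> decay_set \<beta> n)" by (intro open_Int open_growth_set open_decay_set)
    \<comment> \<open>An open set lies in the closure of its intersection with a dense set.\<close>
    have "growth_set \<alpha> n \<subseteq> closure (growth_set \<alpha> n \<inter> decay_set \<beta> n)"
      using open_Int_closure_subset[OF open_growth_set[of \<alpha> n], of "decay_set \<beta> n"]
        closure_decay_set[OF assms(2) adm(1,3), of n] by simp
    then have "closure (growth_set \<alpha> n) \<subseteq> closure (growth_set \<alpha> n \<inter> decay_set \<beta> n)"
      by (rule closure_minimal) simp
    then show "closure (growth_set \<alpha> n \<inter> decay_set \<beta> n) = UNIV"
      using closure_growth_set[OF assms(1) adm(2), of n] by auto
  qed
  have G: "G_set N E \<alpha> \<beta> = (\<Inter>n. growth_set \<alpha> n \<inter> decay_set \<beta> n)"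
    using adm(1) by (rule G_set_eq)
  show "closure (G_set N E \<alpha> \<beta>) = UNIV"
    unfolding G using W by (rule dense_INT_open)
  show "gdelta (G_set N E \<alpha> \<beta>)"
    unfolding G using W(1) by (rule gdelta.intros)
qed

section \<open>Incompatibility of the conclusions\<close>

lemma zero_in_spectrum_of_eigenvalue:
  assumes "eigenvalue (real_part_op E) 0"
  shows "0 \<in> spectrum (real_part_op E)"
proof (rule ccontr)
  assume "0 \<notin> spectrum (real_part_op E)"
  then obtain r where r: "r > 0" "\<And>x. E {z. - r < Re z} x = 0"
    using zero_in_resolvent_real_part_iff unfolding spectrum_def by blast
  obtain u where u: "u \<noteq> 0" "AE z in \<mu> u. Re z = 0"
    using assms unfolding eigenvalue_real_part_iff by blast
  have "AE z in \<mu> u. z \<notin> {z. - r < Re z}"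
    using r(2)[of u] unfolding E_eq_0_iff_AE[OF half_plane_borel(1)] .
  with u(2) have "AE z in \<mu> u. z \<notin> UNIV"
    by eventually_elim (use r(1) in simp)
  then have "E UNIV u = 0" by (simp add: E_eq_0_iff_AE)
  then show False using u(1) by (simp add: E_UNIV)
qed

lemma exponential_decay_limits:
  assumes "exponentially_decaying_orbits N E"
  shows "((\<lambda>t. (t + 1) * norm (T t x)) \<longlongrightarrow> 0) at_top" "((\<lambda>t. T t x) \<longlongrightarrow> 0) at_top"
proof -
  obtain C \<epsilon> where C: "C > 0" "\<epsilon> > 0" "\<And>t. t \<ge> 0 \<Longrightarrow> norm (T t x) \<le> C * exp (- \<epsilon> * t)"
    using assms unfolding exponentially_decaying_orbits_def by blast
  have "eventually (\<lambda>t. norm ((t + 1) * norm (T t x)) \<le> (t + 1) * (C * exp (- \<epsilon> * t))) at_top"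
    using eventually_ge_at_top[of 0]
    by eventually_elim (use C(3) in \<open>simp add: mult_left_mono\<close>)
  moreover have "((\<lambda>t. (t + 1) * (C * exp (- \<epsilon> * t))) \<longlongrightarrow> 0) at_top"
    using C(2) by real_asymp
  ultimately show "((\<lambda>t. (t + 1) * norm (T t x)) \<longlongrightarrow> 0) at_top"
    by (rule Lim_null_comparison)
  have "eventually (\<lambda>t. norm (T t x) \<le> C * exp (- \<epsilon> * t)) at_top"
    using eventually_ge_at_top[of 0] by eventually_elim (rule C(3))
  moreover have "((\<lambda>t. C * exp (- \<epsilon> * t)) \<longlongrightarrow> 0) at_top"
    using C(2) by real_asymp
  ultimately show "((\<lambda>t. T t x) \<longlongrightarrow> 0) at_top"
    by (rule Lim_null_comparison)
qed

lemma admissible_pair_linear: "admissible_pair (\<lambda>t. t + 1) (\<lambda>_. 1)"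
proof -
  have "filterlim (\<lambda>t::real. t + 1) at_top at_top" by real_asymp
  moreover have "((\<lambda>t::real. 1 * exp (- t * \<epsilon>)) \<longlongrightarrow> 0) at_top" if "\<epsilon> > 0" for \<epsilon>
    using that by real_asymp
  ultimately show ?thesis unfolding admissible_pair_def by simp
qed

text \<open>The linear weight is still killed by an exponential rate, which contradicts the infinite
  upper limit; a zero lower limit with weight 1 contradicts the positive lower bound that
  \<open>F_set_iff\<close> gives.\<close>

lemma G_set_linear_not_decaying:
  assumes "x \<in> G_set N E (\<lambda>t. t + 1) (\<lambda>_. 1)"
  shows "\<not> exponentially_decaying_orbits N E" "x \<notin> F_set N E"
proof -
  have x: "x \<in> (\<Inter>n. growth_set (\<lambda>t. t + 1) n \<inter> decay_set (\<lambda>_. 1) n)"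
    using assms G_set_eq[of "\<lambda>_. 1" "\<lambda>t. t + 1"] by simp
  show "\<not> exponentially_decaying_orbits N E"
  proof
    assume "exponentially_decaying_orbits N E"
    then have "((\<lambda>t. (t + 1) * norm (T t x)) \<longlongrightarrow> 0) at_top"
      by (rule exponential_decay_limits)
    then have "eventually (\<lambda>t. (t + 1) * norm (T t x) < 1) at_top"
      by (rule order_tendstoD(2)) simp
    then obtain s where s: "\<And>t. t \<ge> s \<Longrightarrow> (t + 1) * norm (T t x) < 1"
      unfolding eventually_at_top_linorder by blast
    obtain n :: nat where n: "max s 1 \<le> real n" using real_arch_simple by blast
    obtain t where "t \<ge> real n" "real n < (t + 1) * norm (T t x)"
      using x unfolding growth_set_def by blast
    then show False using s[of t] n by simp
  qed
  show "x \<notin> F_set N E"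
  proof
    assume "x \<in> F_set N E"
    then obtain \<epsilon> where \<epsilon>: "\<epsilon> > 0" "\<And>t. t \<ge> 0 \<Longrightarrow> \<epsilon> \<le> norm (T t x)"
      unfolding F_set_iff by blast
    obtain n where n: "inverse (real (Suc n)) < \<epsilon>"
      using reals_Archimedean[OF \<epsilon>(1)] by blast
    obtain t where t: "t \<ge> real n" "1 * norm (T t x) < 1 / real (Suc n)"
      using x unfolding decay_set_def by blast
    have "t \<ge> 0" using t(1) by linarith
    from \<epsilon>(2)[OF this] show False using t(2) n by (simp add: inverse_eq_divide)
  qed
qed

end

theorem theorem1p3:
  fixes N :: "'a::complex_hilbert_space operator"
    and E :: "complex set \<Rightarrow> 'a \<Rightarrow> 'a"
  assumes "normal_operator N"
    and "resolution_of_identity N E"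
    and "{z. Re z > 0} \<subseteq> resolvent_set N"
  shows "(exponentially_decaying_orbits N E \<longleftrightarrow> 0 \<notin> spectrum (real_part_op E)) \<and>
    ((\<forall>\<alpha> \<beta>. admissible_pair \<alpha> \<beta> \<longrightarrow>
        closure (G_set N E \<alpha> \<beta>) = UNIV \<and> gdelta (G_set N E \<alpha> \<beta>)) \<longleftrightarrow>
      0 \<in> spectrum (real_part_op E) \<and> \<not> eigenvalue (real_part_op E) 0) \<and>
    ((closure (F_set N E) = UNIV \<and> open (F_set N E)) \<longleftrightarrow> eigenvalue (real_part_op E) 0)"
proof -
  have N: "N = spectral_integral E (\<lambda>z. z)" and E: "spectral_measure E"
    using assms(2) by (simp_all add: resolution_of_identity_def)
  interpret dissipative_resolution E
    by standard (use E assms(3) N in simp_all)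
  let ?decay = "exponentially_decaying_orbits N E"
  let ?G = "\<forall>\<alpha> \<beta>. admissible_pair \<alpha> \<beta> \<longrightarrow>
    closure (G_set N E \<alpha> \<beta>) = UNIV \<and> gdelta (G_set N E \<alpha> \<beta>)"
  let ?F = "closure (F_set N E) = UNIV \<and> open (F_set N E)"
  let ?spec = "0 \<in> spectrum (real_part_op E)"
  let ?eig = "eigenvalue (real_part_op E) 0"
  have 1: "?eig \<longrightarrow> ?spec"
    using zero_in_spectrum_of_eigenvalue by blast
  have 2: "\<not> ?spec \<longrightarrow> ?decay"
    unfolding N using exponentially_decaying_orbits_of_spectral_gap by blast
  have 3: "?spec \<and> \<not> ?eig \<longrightarrow> ?G"
    unfolding N using G_set_residual by blast
  have 4: "?eig \<longrightarrow> ?F"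
    unfolding N using closure_F_set open_F_set by blast
  have 5: "\<not> (?decay \<and> ?F)"
    unfolding N using exponential_decay_limits(2) by (auto simp: F_set_def)
  have linear: "closure (G_set N E (\<lambda>t. t + 1) (\<lambda>_. 1)) = UNIV" if ?G
    using that admissible_pair_linear by blast
  have 6: "\<not> (?decay \<and> ?G)"
  proof
    assume DG: "?decay \<and> ?G"
    then have "closure (G_set N E (\<lambda>t. t + 1) (\<lambda>_. 1)) = UNIV"
      using linear by simp
    then have "G_set N E (\<lambda>t. t + 1) (\<lambda>_. 1) \<noteq> {}" by auto
    then show False
      using G_set_linear_not_decaying(1) DG unfolding N by blast
  qed
  \<comment> \<open>A nonempty open set meets every dense set, so some vector would lie in
    both.\<close>
  have 7: "\<not> (?G \<and> ?F)"
  proof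
    assume GF: "?G \<and> ?F"
    then have "F_set N E \<noteq> {}" by auto
    moreover have "closure (G_set N E (\<lambda>t. t + 1) (\<lambda>_. 1)) = UNIV"
      using GF linear by simp
    ultimately have "F_set N E \<inter> G_set N E (\<lambda>t. t + 1) (\<lambda>_. 1) \<noteq> {}"
      using open_Int_closure_eq_empty[of "F_set N E" "G_set N E (\<lambda>t. t + 1) (\<lambda>_. 1)"] GF
      by simp
    then show False
      using G_set_linear_not_decaying(2) unfolding N by blast
  qed
  \<comment> \<open>For each converse, a wrong case would produce its own conclusion as well. For
    instance \<open>?decay\<close> with \<open>?spec\<close> yields \<open>?F\<close> or
    \<open>?G\<close>, excluded by 5 and 6.\<close>
  from 1 2 3 4 5 6 7 show ?thesis by argo
qed

end
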